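(* Suppose Assumption A (stated in the context) holds. Then for any initial values $\bm{x}(0)\in\Omega$ and $\bm{\lambda}(0)\in\mathbb{R}^{MN}_+$, there exists a solution $(\bm{x}(\cdot),\bm{\lambda}(\cdot))$ on $[0,+\infty)$, with these initial values, to the differential inclusion $$\dot{\bm{x}}\in\Pi_{\Omega}\big(\bm{x},-\partial_{\bm{x}}\tilde{\mathcal{L}}(\bm{x},\bm{\lambda})\big),\qquad \dot{\bm{\lambda}}\in\Pi_{\mathbb{R}^{MN}_+}\big(\bm{\lambda},-\partial_{\bm{\lambda}}(-\tilde{\mathcal{L}})(\bm{x},\bm{\lambda})\big).$$
   Context: Setting. Let $\mathcal{G}=(\mathcal{V},\mathcal{E})$ be a graph with node set $\mathcal{V}=\{1,\dots,N\}$; $\mathcal{N}_i$ is the set of neighbors of node $i$. For each $i\in\mathcal{V}$ let $\Omega_i\subset\mathbb{R}^{n_i}$, let $f_i$ be a real-valued function and $\bm{g}_i=(g_{i1},\dots,g_{iM})^T$ an $\mathbb{R}^M$-valued map, both defined on an open convex set containing $\Omega_i$. Write $\bm{x}=\mathrm{col}(x_1,\dots,x_N)$ for the stacked vector, $\Omega=\prod_{i\in\mathcal{V}}\Omega_i$, $\bm{g}(\bm{x})=\sum_i\bm{g}_i(x_i)$. Vector inequalities are componentwise; $|\cdot|$ is the $\ell_1$-norm of vectors; $\mathbb{R}^n_+$ is the set of vectors with nonnegative components. Assumption A. (1) For every $i\in\mathcal{V}$, $\Omega_i$ is compact and convex, and on the open set containing $\Omega_i$, $f_i$ is strictly convex,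 $\bm{g}_i$ is convex (i.e. each $g_{ik}$ is convex), and $f_i$, $\bm{g}_i$ are locally Lipschitz continuous. (2) There is $\bar{\bm{x}}$ in the relative interior of $\Omega$ with $\bm{g}(\bar{\bm{x}})<\bm{0}$. (3) $\mathcal{G}$ is connected and undirected. For $\bm{\lambda}=\mathrm{col}(\lambda_1,\dots,\lambda_N)$ with $\lambda_i\in\mathbb{R}^M_+$, the modified Lagrangian, with a constant $K>0$, is $$\tilde{\mathcal{L}}(\bm{x},\bm{\lambda})=\sum_{i\in\mathcal{V}}\big(f_i(x_i)+\lambda_i^T\bm{g}_i(x_i)\big)-K\phi(\bm{\lambda}),\qquad \phi(\bm{\lambda})=\tfrac12\sum_{i\in\mathcal{V}}\sum_{j\in\mathcal{N}_i}|\lambda_i-\lambda_j|.$$ It is convex in $\bm{x}$ and concave in $\bm{\lambda}$. $\partial_{\bm{x}}\tilde{\mathcal{L}}$ is the convex subdifferential in $\bm{x}$, and $\partial_{\bm{\lambda}}(-\tilde{\mathcal{L}})$ the convex subdifferential of $-\tilde{\mathcal{L}}$ in $\bm{\lambda}$ (the formula for $\tilde{\mathcal L}$ being used for all $\bm{\lambda}\in\mathbb{R}^{MN}$). Explicitly, the $i$-th block of $\partial_{\bm{x}}\tilde{\mathcal{L}}$ is $\partial f_i(x_i)+\partial\bm{g}_i(x_i)\lambda_i$ (meaning $\partial f_i(x_i)+\sum_k\lambda_{ik}\partial g_{ik}(x_i)$). For a closed convex set $C\subset\mathbb{R}^n$ and $x\in C$, the tangent cone $\mathcal{T}_C(x)$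 is the set of limits $\lim_k (x_k-x)/t_k$ with $x_k\in C$, $x_k\to x$, $t_k>0$, $t_k\to0$; $P_C$ is Euclidean projection onto $C$; and $\Pi_C(x,z)=P_{\mathcal{T}_C(x)}(z)$, with $\Pi_C(x,Z)=\{\Pi_C(x,z):z\in Z\}$ for a set $Z$. A solution of a differential inclusion is a map on $[0,+\infty)$ that is absolutely continuous (on bounded intervals), has the given initial value, and satisfies the inclusion for almost all $t\in[0,+\infty)$ (here with $\bm{x}(t)\in\Omega$ and $\bm{\lambda}(t)\in\mathbb{R}^{MN}_+$ for all $t$, so that the right-hand side is defined). *)

theory Defs
  imports "HOL-Analysis.Analysis"
begin

section \<open>Convex analysis\<close>

definition strictly_convex_on :: "'a::real_vector set \<Rightarrow> ('a \<Rightarrow> real) \<Rightarrow> bool" where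
  "strictly_convex_on D h \<longleftrightarrow> convex D \<and>
     (\<forall>x\<in>D. \<forall>y\<in>D. \<forall>u. x \<noteq> y \<and> 0 < u \<and> u < 1 \<longrightarrow>
        h ((1 - u) *\<^sub>R x + u *\<^sub>R y) < (1 - u) * h x + u * h y)"

definition locally_lipschitz_on :: "'a::metric_space set \<Rightarrow> ('a \<Rightarrow> 'b::metric_space) \<Rightarrow> bool" where
  "locally_lipschitz_on D h \<longleftrightarrow> (\<forall>x\<in>D. \<exists>u>0. \<exists>L. L-lipschitz_on (cball x u \<inter> D) h)"

text \<open>Convex subdifferential at \<open>x\<close> of a function with domain \<open>D\<close>; the values
  of \<open>h\<close> outside \<open>D\<close> play no role.\<close>

definition subdifferential :: "'a::real_inner set \<Rightarrow> ('a \<Rightarrow> real) \<Rightarrow> 'a \<Rightarrow> 'a set" where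
  "subdifferential D h x = {v. \<forall>y\<in>D. h x + v \<bullet> (y - x) \<le> h y}"

definition tangent_cone :: "'a::real_normed_vector set \<Rightarrow> 'a \<Rightarrow> 'a set" where
  "tangent_cone C x = {v. \<exists>(X :: nat \<Rightarrow> 'a) (t :: nat \<Rightarrow> real).
     (\<forall>k. X k \<in> C) \<and> X \<longlonglongrightarrow> x \<and> (\<forall>k. 0 < t k) \<and> t \<longlonglongrightarrow> 0 \<and>
     (\<lambda>k. (X k - x) /\<^sub>R t k) \<longlonglongrightarrow> v}"

definition proj_tangent :: "'a::euclidean_space set \<Rightarrow> 'a \<Rightarrow> 'a \<Rightarrow> 'a" where
  "proj_tangent C x z = closest_point (tangent_cone C x) z"

section \<open>Absolute continuity on a compact interval\<close>

definition abs_continuous_on :: "real \<Rightarrow> real \<Rightarrow> (real \<Rightarrow> 'a::metric_space) \<Rightarrow> bool" where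
  "abs_continuous_on a b h \<longleftrightarrow>
     (\<forall>\<epsilon>>0. \<exists>\<delta>>0. \<forall>I :: (real \<times> real) set.
        finite I \<and> (\<forall>(c, d)\<in>I. a \<le> c \<and> c \<le> d \<and> d \<le> b) \<and>
        disjoint_family_on (\<lambda>(c, d). {c<..<d}) I \<and> (\<Sum>(c, d)\<in>I. d - c) < \<delta>
        \<longrightarrow> (\<Sum>(c, d)\<in>I. dist (h c) (h d)) < \<epsilon>)"

section \<open>Stacked vectors with blocks of different dimensions\<close>

text \<open>The nodes are the elements of the finite type \<open>'v\<close>. The scalar coordinates of the
  stacked vector are indexed by the finite type \<open>'n\<close>, and \<open>own c\<close> is the node to which
  coordinate \<open>c\<close> belongs. The dimension \<open>n\<^sub>i\<close> is the number of coordinates owned by \<open>i\<close>, and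
  the Euclidean space of dimension \<open>n\<^sub>i\<close> is identified with the coordinate subspace
  \<open>block_space own i\<close>, so that the stacked vectors form the whole space \<open>real ^ 'n\<close>.\<close>

definition block_space :: "('n::finite \<Rightarrow> 'v) \<Rightarrow> 'v \<Rightarrow> (real ^ 'n) set" where
  "block_space own i = {y. \<forall>c. own c \<noteq> i \<longrightarrow> y $ c = 0}"

definition block :: "('n::finite \<Rightarrow> 'v) \<Rightarrow> 'v \<Rightarrow> real ^ 'n \<Rightarrow> real ^ 'n" where
  "block own i x = (\<chi> c. if own c = i then x $ c else 0)"

definition block_prod :: "('n::finite \<Rightarrow> 'v) \<Rightarrow> ('v \<Rightarrow> (real ^ 'n) set) \<Rightarrow> (real ^ 'n) set" where
  "block_prod own S = {x. \<forall>i. block own i x \<in> S i}"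

section \<open>The modified Lagrangian and the differential inclusion\<close>

definition l1_norm :: "real ^ 'm::finite \<Rightarrow> real" where
  "l1_norm v = (\<Sum>k\<in>UNIV. \<bar>v $ k\<bar>)"

definition neighbors :: "'v rel \<Rightarrow> 'v \<Rightarrow> 'v set" where
  "neighbors E i = {j. (i, j) \<in> E}"

definition consensus_penalty :: "'v::finite rel \<Rightarrow> real ^ 'm::finite ^ 'v \<Rightarrow> real" where
  "consensus_penalty E lam = 1 / 2 * (\<Sum>i\<in>UNIV. \<Sum>j\<in>neighbors E i. l1_norm (lam $ i - lam $ j))"

definition modified_lagrangian ::
  "('n::finite \<Rightarrow> 'v::finite) \<Rightarrow> 'v rel \<Rightarrow> real \<Rightarrow> ('v \<Rightarrow> real ^ 'n \<Rightarrow> real) \<Rightarrow>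
   ('v \<Rightarrow> real ^ 'n \<Rightarrow> real ^ 'm::finite) \<Rightarrow> real ^ 'n \<Rightarrow> real ^ 'm ^ 'v \<Rightarrow> real" where
  "modified_lagrangian own E K f g x lam =
     (\<Sum>i\<in>UNIV. f i (block own i x) + lam $ i \<bullet> g i (block own i x)) - K * consensus_penalty E lam"

definition nonneg_multipliers :: "(real ^ 'm::finite ^ 'v::finite) set" where
  "nonneg_multipliers = {lam. \<forall>i k. 0 \<le> lam $ i $ k}"

text \<open>\<open>W\<close> is the constraint set of \<open>x\<close> and \<open>D\<close> the domain on which \<open>L\<close> is given in its
  first argument; in the second argument the domain of \<open>L\<close> is the whole space.\<close>

definition is_projected_saddle_flow ::
  "'a::euclidean_space set \<Rightarrow> 'a set \<Rightarrow> ('a \<Rightarrow> real ^ 'm::finite ^ 'v::finite \<Rightarrow> real) \<Rightarrow>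
   'a \<Rightarrow> real ^ 'm ^ 'v \<Rightarrow> (real \<Rightarrow> 'a) \<Rightarrow> (real \<Rightarrow> real ^ 'm ^ 'v) \<Rightarrow> bool" where
  "is_projected_saddle_flow W D L x0 lam0 x lam \<longleftrightarrow>
     x 0 = x0 \<and> lam 0 = lam0 \<and>
     (\<forall>t\<ge>0. x t \<in> W \<and> lam t \<in> nonneg_multipliers) \<and>
     (\<forall>T\<ge>0. abs_continuous_on 0 T x \<and> abs_continuous_on 0 T lam) \<and>
     (AE t in lebesgue. 0 \<le> t \<longrightarrow>
        (\<exists>x' lam'.
           (x has_vector_derivative x') (at t within {0..}) \<and>
           (lam has_vector_derivative lam') (at t within {0..}) \<and>
           x' \<in> proj_tangent W (x t) `
                  (uminus ` subdifferential D (\<lambda>y. L y (lam t)) (x t)) \<and>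
           lam' \<in> proj_tangent nonneg_multipliers (lam t) `
                  (uminus ` subdifferential UNIV (\<lambda>mu. - L (x t) mu) (lam t))))"

end

theory Submission
  imports Defs "HOL-Complex_Analysis.Great_Picard"
begin

text \<open>
  Write \<open>u = (x, \<lambda>)\<close> and let \<open>Z\<close> be the closed convex set of admissible pairs. For \<open>L\<close>
  convex in \<open>x\<close> and concave in \<open>\<lambda>\<close> the operator \<open>A u = \<partial>\<^sub>x L \<times> \<partial>\<^sub>\<lambda>(-L)\<close> is monotone, and the
  inclusion is the flow of \<open>-A\<close> constrained to \<open>Z\<close>. The solution is a limit of projected explicit Euler steps
  \<open>u\<^sub>n\<^sub>+\<^sub>1 = P\<^sub>Z (u\<^sub>n - h v\<^sub>n)\<close> with an arbitrary selection \<open>v\<^sub>n \<in> A u\<^sub>n\<close>. The right-hand side is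
  discontinuous in \<open>u\<close>, so one cannot pass to the limit in the steps themselves. Instead, the
  subgradient inequalities turn each step, for every \<open>z = (y, \<mu>) \<in> Z\<close>, into
  \<open>|u\<^sub>n\<^sub>+\<^sub>1 - z|\<^sup>2 \<le> |u\<^sub>n - z|\<^sup>2 - 2h (L(x\<^sub>n, \<mu>) - L(y, \<lambda>\<^sub>n)) + O(h\<^sup>2)\<close>, where only values of the
  continuous function \<open>L\<close> remain. Subgradients grow at most linearly in \<open>u\<close>, so the steps
  are Lipschitz on bounded time intervals uniformly in \<open>h\<close>, a subsequence converges, and
  wherever the Lipschitz limit \<open>u\<close> is differentiable it satisfies
  \<open>L(x, \<mu>) - L(y, \<lambda>) \<le> \<langle>-u', u - z\<rangle>\<close> for all \<open>z \<in> Z\<close>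
  (\<open>evolution_variational_inequality\<close>, stated for a general drift field).

  Differentiability almost everywhere is Lebesgue's theorem for Lipschitz curves, derived from
  the Vitali covering theorem (\<open>lipschitz_ae_vector_derivative\<close>).

  Taking \<open>\<mu> = \<lambda>\<close> or \<open>y = x\<close> in the variational inequality shows that \<open>-x'\<close> and \<open>-\<lambda>'\<close> are
  subgradients relative to the constraint set. By separation of convex sets such a relative
  subgradient is a true subgradient \<open>p\<close> plus a normal vector \<open>n\<close>
  (\<open>subgradient_of_constrained\<close>). The curve stays in the constraint set both before and after
  time \<open>t\<close>, so its velocity is tangent and orthogonal to all normals. Hence
  \<open>-p = x' + n\<close> with \<open>x'\<close> in the tangent cone and \<open>n \<bottom> x'\<close> normal, which says that \<open>x'\<close> is the
  projection of \<open>-p\<close> onto the tangent cone (\<open>velocity_is_projected_subgradient\<close>).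

  For the modified Lagrangian it remains to see that it is convex in \<open>x\<close> and concave in \<open>\<lambda>\<close>, and
  that its subgradients grow at most linearly; the latter holds since it is affine in \<open>\<lambda>\<close> up to
  a seminorm and \<open>\<Omega>\<close> is a compact subset of an open domain.
\<close>

section \<open>Lipschitz curves are differentiable almost everywhere\<close>

text \<open>In one dimension balls are intervals, and the point to be covered may lie anywhere in its
  interval; this is what lets one-sided difference quotients be used.\<close>

lemma Vitali_covering_intervals:
  fixes S U :: "real set" and P :: "real \<Rightarrow> real \<Rightarrow> bool"
  assumes U: "open U" "S \<subseteq> U"
    and fine: "\<And>x \<delta>. x \<in> S \<Longrightarrow> \<delta> > 0 \<Longrightarrow> \<exists>c d. c \<le> x \<and> x \<le> d \<and> c < d \<and> d - c < \<delta> \<and> P c d"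
  obtains C where "countable C" "\<And>c d. (c, d) \<in> C \<Longrightarrow> c < d \<and> {c..d} \<subseteq> U \<and> P c d"
    "disjoint_family_on (\<lambda>(c, d). {c..d}) C" "negligible (S - (\<Union>(c, d)\<in>C. {c..d}))"
proof -
  define K where "K = {(c, d). c < d \<and> {c..d} \<subseteq> U \<and> P c d}"
  define a r where "a = (\<lambda>(c, d). (c + d) / 2 :: real)" and "r = (\<lambda>(c, d). (d - c) / 2 :: real)"
  have ball_eq: "cball (a i) (r i) = (case i of (c, d) \<Rightarrow> {c..d})" for i
    by (auto simp: a_def r_def cball_eq_atLeastAtMost field_simps split: prod.splits)
  have fine': "\<exists>i. i \<in> K \<and> x \<in> cball (a i) (r i) \<and> r i < \<delta>" if x: "x \<in> S" "\<delta> > 0" for x \<delta>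
  proof -
    obtain e where e: "e > 0" "ball x e \<subseteq> U"
      using U x by (meson open_contains_ball subsetD)
    obtain c d where cd: "c \<le> x" "x \<le> d" "c < d" "d - c < min e \<delta>" "P c d"
      using fine[of x "min e \<delta>"] x e by auto
    have "{c..d} \<subseteq> ball x e" using cd by (auto simp: dist_real_def)
    then have "(c, d) \<in> K" using cd e by (auto simp: K_def)
    moreover have "x \<in> cball (a (c, d)) (r (c, d))" using cd by (simp add: ball_eq)
    moreover have "r (c, d) < \<delta>" using cd by (simp add: r_def)
    ultimately show ?thesis by blast
  qed
  have pos: "0 < r i" if "i \<in> K" for i using that by (auto simp: K_def r_def)
  obtain C where C: "countable C" "C \<subseteq> K"
     "pairwise (\<lambda>i j. disjnt (cball (a i) (r i)) (cball (a j) (r j))) C"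
     "negligible (S - (\<Union>i \<in> C. cball (a i) (r i)))"
    using Vitali_covering_theorem_cballs[of K r S a, OF pos fine'] by blast
  show ?thesis
  proof
    show "countable C" by fact
    show "c < d \<and> {c..d} \<subseteq> U \<and> P c d" if "(c, d) \<in> C" for c d using that C(2) by (auto simp: K_def)
    show "disjoint_family_on (\<lambda>(c, d). {c..d}) C"
      using C(3) unfolding ball_eq by (auto simp: disjoint_family_on_def pairwise_def disjnt_def)
    show "negligible (S - (\<Union>(c, d)\<in>C. {c..d}))"
      using C(4) unfolding ball_eq by (auto simp: case_prod_beta)
  qed
qed

lemma emeasure_disjoint_intervals_mono:
  fixes C :: "(real \<times> real) set"
  assumes C: "countable C" "disjoint_family_on (\<lambda>(c, d). {c..d}) C"
    and sets: "sets borel \<subseteq> sets M" "sets borel \<subseteq> sets N"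
    and le: "\<And>c d. (c, d) \<in> C \<Longrightarrow> k * emeasure M {c..d} \<le> l * emeasure N {c..d}"
  shows "k * emeasure M (\<Union>(c, d)\<in>C. {c..d}) \<le> l * emeasure N (\<Union>(c, d)\<in>C. {c..d})"
proof -
  have M: "emeasure M (\<Union>(c, d)\<in>C. {c..d}) = (\<integral>\<^sup>+i. emeasure M (case i of (c, d) \<Rightarrow> {c..d}) \<partial>count_space C)"
    using sets by (intro emeasure_UN_countable C) (auto split: prod.splits)
  have N: "emeasure N (\<Union>(c, d)\<in>C. {c..d}) = (\<integral>\<^sup>+i. emeasure N (case i of (c, d) \<Rightarrow> {c..d}) \<partial>count_space C)"
    using sets by (intro emeasure_UN_countable C) (auto split: prod.splits)
  show ?thesis unfolding M N
    by (simp flip: nn_integral_cmult) (intro nn_integral_mono; use le in \<open>auto split: prod.splits\<close>)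
qed

lemma negligible_countable_set: "countable (C :: real set) \<Longrightarrow> negligible C"
  by (simp add: countable_imp_null_set_lborel negligible_iff_null_sets null_sets_completionI)

text \<open>The sets of non-differentiability below are not known to be measurable in advance, so their
  size is measured by the outer measure.\<close>

lemma outer_measure_of_le_cover:
  assumes "V \<in> sets M" "N \<in> null_sets M" "S \<subseteq> V \<union> N"
  shows "outer_measure_of M S \<le> emeasure M V"
proof -
  have "outer_measure_of M S \<le> outer_measure_of M (V \<union> N)"
    by (rule outer_measure_of_mono) fact
  also have "\<dots> = emeasure M (V \<union> N)" using assms by auto
  also have "\<dots> = emeasure M V" using assms by (simp add: emeasure_Un_null_set)
  finally show ?thesis .
qed

text \<open>The heart of Lebesgue's theorem: near a point of \<open>S\<close> the increasing function \<open>G\<close> has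
  arbitrarily short chords of slope at most \<open>p\<close> and others of slope at least \<open>q\<close>. Vitali families
  of the flat chords, and of steep chords inside them, compare the Stieltjes measure \<open>\<mu>\<close> of \<open>G\<close>
  with Lebesgue measure \<open>m\<close> and give \<open>q m(S) \<le> \<mu>(steep) \<le> \<mu>(flat) \<le> p (m(S) + \<epsilon>)\<close>.\<close>

lemma negligible_two_derivates:
  fixes G :: "real \<Rightarrow> real"
  assumes mono: "mono G" and cont: "continuous_on UNIV G" and pq: "0 \<le> p" "p < q"
    and S: "bounded S"
    and lo: "\<And>x \<delta>. x \<in> S \<Longrightarrow> \<delta> > 0 \<Longrightarrow>
      \<exists>c d. c \<le> x \<and> x \<le> d \<and> c < d \<and> d - c < \<delta> \<and> G d - G c \<le> p * (d - c)"
    and hi: "\<And>x \<delta>. x \<in> S \<Longrightarrow> \<delta> > 0 \<Longrightarrow>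
      \<exists>c d. c \<le> x \<and> x \<le> d \<and> c < d \<and> d - c < \<delta> \<and> q * (d - c) \<le> G d - G c"
  shows "negligible S"
proof -
  define \<mu> where "\<mu> = interval_measure G"
  have \<mu>: "emeasure \<mu> {c..d} = ennreal (G d - G c)" if "c \<le> d" for c d
    unfolding \<mu>_def using that mono cont
    by (intro emeasure_interval_measure_Icc) (auto simp: mono_def)
  have sets\<mu>: "sets \<mu> = sets borel" by (simp add: \<mu>_def)
  \<comment> \<open>A measurable hull \<open>H\<close> of \<open>S\<close>, of the same outer measure.\<close>
  obtain H where H: "H \<in> sets lebesgue" "S \<subseteq> H" "outer_measure_of lebesgue S = emeasure lebesgue H"
    using outer_measure_of_attain[of S lebesgue] by auto
  obtain b where b: "S \<subseteq> ball 0 b" using bounded_subset_ballD[OF S] by blast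
  have "outer_measure_of lebesgue S \<le> emeasure lebesgue (ball 0 b :: real set)"
    using outer_measure_of_mono[OF b, of lebesgue] by simp
  also have "\<dots> < \<infinity>" using lmeasurable_ball fmeasurableD2 by (metis infinity_ennreal_def less_top)
  finally have fin: "emeasure lebesgue H < \<infinity>" using H by simp
  define h where "h = measure lebesgue H"
  have eh: "emeasure lebesgue H = ennreal h" unfolding h_def
    using fin by (simp add: emeasure_eq_ennreal_measure less_top)
  have h0: "h \<ge> 0" by (simp add: h_def)
  have key: "q * h \<le> p * (h + \<epsilon>)" if \<epsilon>: "\<epsilon> > 0" for \<epsilon>
  proof -
    obtain U where U: "open U" "H \<subseteq> U" "U - H \<in> lmeasurable" "emeasure lebesgue (U - H) < ennreal \<epsilon>"
      using sets_lebesgue_outer_open[OF H(1) \<epsilon>] by blast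
    have "emeasure lebesgue U = emeasure lebesgue H + emeasure lebesgue (U - H)"
      using U H by (subst plus_emeasure) (auto simp: Un_absorb1)
    also have "\<dots> \<le> ennreal h + ennreal \<epsilon>" using U eh by (intro add_mono) auto
    also have "\<dots> = ennreal (h + \<epsilon>)" using h0 that by simp
    finally have mU: "emeasure lebesgue U \<le> ennreal (h + \<epsilon>)" .
    obtain C where C: "countable C" "\<And>c d. (c, d) \<in> C \<Longrightarrow> c < d \<and> {c..d} \<subseteq> U \<and> G d - G c \<le> p * (d - c)"
      "disjoint_family_on (\<lambda>(c, d). {c..d}) C" "negligible (S - (\<Union>(c, d)\<in>C. {c..d}))"
      by (rule Vitali_covering_intervals[of U S "\<lambda>c d. G d - G c \<le> p * (d - c)"])
        (use U H lo in auto)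
    \<comment> \<open>The steep family must lie in an open set, so it is chosen inside the union \<open>W\<close> of the
      interiors; the end points lost are countably many.\<close>
    define V where "V = (\<Union>(c, d)\<in>C. {c..d})"
    define W where "W = (\<Union>(c, d)\<in>C. {c<..<d})"
    have W: "open W" by (auto simp: W_def)
    obtain C' where C': "countable C'" "\<And>c d. (c, d) \<in> C' \<Longrightarrow> c < d \<and> {c..d} \<subseteq> W \<and> q * (d - c) \<le> G d - G c"
      "disjoint_family_on (\<lambda>(c, d). {c..d}) C'" "negligible ((S \<inter> W) - (\<Union>(c, d)\<in>C'. {c..d}))"
      by (rule Vitali_covering_intervals[of W "S \<inter> W" "\<lambda>c d. q * (d - c) \<le> G d - G c"])
        (use W hi in auto)
    define V' where "V' = (\<Union>(c, d)\<in>C'. {c..d})"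
    have bV: "V \<in> sets borel" "V' \<in> sets borel"
      unfolding V_def V'_def using C(1) C'(1) by (auto intro!: sets.countable_UN' split: prod.splits)
    have "W \<subseteq> V" unfolding W_def V_def by (intro UN_mono) auto
    moreover have "V' \<subseteq> W" using C'(2) unfolding V'_def by blast
    ultimately have V'V: "V' \<subseteq> V" by auto
    have VU: "V \<subseteq> U" using C(2) unfolding V_def by blast
    define Z where "Z = (S - V) \<union> ((S \<inter> W) - V') \<union> (fst ` C \<union> snd ` C)"
    have "negligible Z"
      using C(4) C'(4) negligible_countable_set[of "fst ` C \<union> snd ` C"] C(1)
      unfolding Z_def V_def V'_def by (metis countable_Un countable_image negligible_Un)
    then have Z: "Z \<in> null_sets lebesgue" by (simp add: negligible_iff_null_sets)
    have "S \<subseteq> V' \<union> Z"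
    proof
      fix x assume x: "x \<in> S"
      show "x \<in> V' \<union> Z"
      proof (cases "x \<in> V")
        case True
        then obtain c d where cd: "(c, d) \<in> C" "c \<le> x" "x \<le> d" by (auto simp: V_def)
        show ?thesis
        proof (cases "x = c \<or> x = d")
          case True then show ?thesis using cd unfolding Z_def by force
        next
          case False
          then have "x \<in> W" using cd by (force simp: W_def)
          then show ?thesis using x by (auto simp: Z_def)
        qed
      qed (use x in \<open>auto simp: Z_def\<close>)
    qed
    then have hV: "ennreal h \<le> emeasure lebesgue V'"
      using outer_measure_of_le_cover[of V' lebesgue Z S] bV Z H(3) eh by auto
    have len: "emeasure lebesgue {c..d} = ennreal (d - c)" if "c \<le> d" for c d :: real
      using that by simp
    have "ennreal q * ennreal h \<le> ennreal q * emeasure lebesgue V'"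
      by (intro mult_left_mono hV) auto
    also have "\<dots> \<le> 1 * emeasure \<mu> V'" unfolding V'_def
    proof (rule emeasure_disjoint_intervals_mono[OF C'(1,3)])
      fix c d assume "(c, d) \<in> C'"
      from C'(2)[OF this] have "c < d" "q * (d - c) \<le> G d - G c" by auto
      then show "ennreal q * emeasure lebesgue {c..d} \<le> 1 * emeasure \<mu> {c..d}"
        using pq by (simp add: \<mu> ennreal_leI flip: ennreal_mult)
    qed (auto simp: sets\<mu>)
    also have "\<dots> \<le> 1 * emeasure \<mu> V"
      using V'V bV by (simp add: emeasure_mono sets\<mu>)
    also have "\<dots> \<le> ennreal p * emeasure lebesgue V" unfolding V_def
    proof (rule emeasure_disjoint_intervals_mono[OF C(1,3)])
      fix c d assume "(c, d) \<in> C"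
      from C(2)[OF this] have "c < d" "G d - G c \<le> p * (d - c)" by auto
      then show "1 * emeasure \<mu> {c..d} \<le> ennreal p * emeasure lebesgue {c..d}"
        using pq by (simp add: \<mu> ennreal_leI flip: ennreal_mult)
    qed (auto simp: sets\<mu>)
    also have "\<dots> \<le> ennreal p * ennreal (h + \<epsilon>)"
      using emeasure_mono[OF VU, of lebesgue] mU U(1)
      by (intro mult_left_mono) (auto intro: order_trans)
    finally show ?thesis using pq h0 that
      by (simp flip: ennreal_mult add: ennreal_le_iff del: ennreal_plus)
  qed
  have "q * h \<le> p * h"
  proof (rule field_le_epsilon)
    fix e :: real assume "e > 0"
    then have "p * (e / (p + 1)) \<le> e" using pq by (simp add: field_simps)
    then show "q * h \<le> p * h + e"
      using key[of "e / (p + 1)"] pq \<open>e > 0\<close> by (simp add: distrib_left)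
  qed
  then have "h = 0" using h0 pq by (metis antisym_conv2 mult_le_cancel_right nless_le not_le)
  then have "H \<in> null_sets lebesgue" using H eh by auto
  then show ?thesis using H(2) negligible_iff_null_sets negligible_subset by blast
qed

lemma bounded_convergent_or_oscillates:
  fixes \<phi> :: "real \<Rightarrow> real"
  assumes F: "F \<noteq> bot" and B: "eventually (\<lambda>h. \<bar>\<phi> h\<bar> \<le> B) F" and ndiv: "\<nexists>l. (\<phi> \<longlongrightarrow> l) F"
  obtains p q :: rat where "p < q" "frequently (\<lambda>h. \<phi> h < of_rat p) F" "frequently (\<lambda>h. of_rat q < \<phi> h) F"
proof -
  let ?f = "\<lambda>h. ereal (\<phi> h)"
  have lo: "ereal (- B) \<le> Liminf F ?f" by (rule Liminf_bounded) (use B in \<open>auto elim!: eventually_mono\<close>)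
  have hi: "Limsup F ?f \<le> ereal B" by (rule Limsup_bounded) (use B in \<open>auto elim!: eventually_mono\<close>)
  have le: "Liminf F ?f \<le> Limsup F ?f" by (rule Liminf_le_Limsup) (use F in auto)
  have "Liminf F ?f \<noteq> Limsup F ?f"
  proof
    assume eq: "Liminf F ?f = Limsup F ?f"
    have "\<bar>Limsup F ?f\<bar> \<noteq> \<infinity>" using lo hi eq by auto
    then obtain l where l: "Limsup F ?f = ereal l" by (metis ereal_real)
    have "(?f \<longlongrightarrow> ereal l) F" using tendsto_iff_Liminf_eq_Limsup[of F ?f "ereal l"] F eq l by simp
    then show False using ndiv by (simp add: lim_ereal)
  qed
  with le have "Liminf F ?f < Limsup F ?f" by simp
  then obtain p where p: "Liminf F ?f < real_of_rat p" "real_of_rat p < Limsup F ?f" using ereal_dense3 by blast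
  then obtain q where q: "ereal (real_of_rat p) < real_of_rat q" "real_of_rat q < Limsup F ?f" using ereal_dense3 by blast
  show ?thesis
  proof
    show "p < q" using q by (simp add: of_rat_less)
    show "frequently (\<lambda>h. \<phi> h < of_rat p) F"
    proof (rule ccontr)
      assume "\<not> ?thesis"
      then have "eventually (\<lambda>h. ereal (of_rat p) \<le> ?f h) F" by (simp add: frequently_def not_less)
      from Liminf_bounded[OF this] p show False by auto
    qed
    show "frequently (\<lambda>h. of_rat q < \<phi> h) F"
    proof (rule ccontr)
      assume "\<not> ?thesis"
      then have "eventually (\<lambda>h. ?f h \<le> ereal (of_rat q)) F" by (simp add: frequently_def not_less)
      from Limsup_bounded[OF this] q show False by auto
    qed
  qed
qed

text \<open>A difference quotient at \<open>x\<close> with increment of either sign is the slope of a chord over an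
  interval that has \<open>x\<close> as an end point.\<close>

lemma frequently_at_0_interval:
  fixes G :: "real \<Rightarrow> real"
  assumes "frequently (\<lambda>h. P ((G (x + h) - G x) / h)) (at 0)" "\<delta> > 0"
  shows "\<exists>c d. c \<le> x \<and> x \<le> d \<and> c < d \<and> d - c < \<delta> \<and> P ((G d - G c) / (d - c))"
proof -
  obtain h where h: "h \<noteq> 0" "\<bar>h\<bar> < \<delta>" "P ((G (x + h) - G x) / h)"
    using assms unfolding frequently_at by (auto simp: dist_real_def)
  show ?thesis
  proof (cases "h > 0")
    case True
    then show ?thesis using h by (intro exI[of _ x] exI[of _ "x + h"]) auto
  next
    case False
    have "(G x - G (x + h)) / (- h) = (G (x + h) - G x) / h"
      by (metis minus_diff_eq minus_divide_divide)
    then show ?thesis using h False by (intro exI[of _ "x + h"] exI[of _ x]) auto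
  qed
qed

text \<open>Where the bounded difference quotients fail to converge, they oscillate across a pair of
  rationals \<open>p < q\<close>; there are countably many such pairs.\<close>

lemma negligible_not_differentiable_real:
  fixes F :: "real \<Rightarrow> real"
  assumes lip: "L-lipschitz_on UNIV F"
  shows "negligible {x. \<not> F differentiable (at x)}"
proof -
  have L0: "L \<ge> 0" using lip by (rule lipschitz_on_nonneg)
  have lipD: "\<bar>F y - F x\<bar> \<le> L * \<bar>y - x\<bar>" for x y
    using lipschitz_onD[OF lip, of y x] by (simp add: dist_real_def)
  \<comment> \<open>Adding \<open>L x\<close> makes the function increasing and changes every slope by the constant \<open>L\<close>.\<close>
  define G where "G = (\<lambda>x. F x + L * x)"
  have mono: "mono G"
  proof (rule monoI)
    fix x y :: real assume "x \<le> y"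
    then show "G x \<le> G y" using lipD[of y x] by (simp add: G_def algebra_simps abs_le_iff)
  qed
  have cont: "continuous_on UNIV G"
    unfolding G_def by (intro continuous_intros lipschitz_on_continuous_on[OF lip])
  define S where "S = (\<lambda>(p, q, n). {x. \<bar>x\<bar> < real n \<and>
     frequently (\<lambda>h. (G (x + h) - G x) / h < real_of_rat p) (at 0) \<and>
     frequently (\<lambda>h. real_of_rat q < (G (x + h) - G x) / h) (at 0)})"
  have quot0: "0 \<le> (G (x + h) - G x) / h" for x h
    using monoD[OF mono, of x "x + h"] monoD[OF mono, of "x + h" x]
    by (cases h "0::real" rule: linorder_cases) (auto simp: zero_le_divide_iff)
  have negS: "negligible (S (p, q, n))" if pq: "p < q" for p q n
  proof (cases "0 \<le> p")
    case True
    show ?thesis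
    proof (rule negligible_two_derivates[OF mono cont, of "of_rat p" "of_rat q"])
      show "bounded (S (p, q, n))" unfolding S_def by (auto simp: bounded_real intro!: exI[of _ "real n"])
      fix x \<delta> :: real assume x: "x \<in> S (p, q, n)" and \<delta>: "\<delta> > 0"
      have *: "frequently (\<lambda>h. (G (x + h) - G x) / h < real_of_rat p) (at 0)"
        "frequently (\<lambda>h. real_of_rat q < (G (x + h) - G x) / h) (at 0)" using x by (auto simp: S_def)
      from frequently_at_0_interval[OF *(1) \<delta>]
      obtain c d where "c \<le> x" "x \<le> d" "c < d" "d - c < \<delta>" "(G d - G c) / (d - c) < real_of_rat p" by blast
      then show "\<exists>c d. c \<le> x \<and> x \<le> d \<and> c < d \<and> d - c < \<delta> \<and> G d - G c \<le> real_of_rat p * (d - c)"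
        by (intro exI[of _ c] exI[of _ d]) (auto simp: pos_divide_less_eq)
      from frequently_at_0_interval[OF *(2) \<delta>]
      obtain c d where "c \<le> x" "x \<le> d" "c < d" "d - c < \<delta>" "real_of_rat q < (G d - G c) / (d - c)" by blast
      then show "\<exists>c d. c \<le> x \<and> x \<le> d \<and> c < d \<and> d - c < \<delta> \<and> real_of_rat q * (d - c) \<le> G d - G c"
        by (intro exI[of _ c] exI[of _ d]) (auto simp: pos_less_divide_eq)
    qed (use pq True in \<open>auto simp: of_rat_less\<close>)
  next
    case False
    then have "real_of_rat p < 0" by simp
    then have "\<not> (G (x + h) - G x) / h < real_of_rat p" for x h using quot0[of x h] by linarith
    then have "S (p, q, n) = {}" by (auto simp: S_def)
    then show ?thesis by simp
  qed
  have sub: "{x. \<not> F differentiable (at x)} \<subseteq> \<Union> (S ` {(p, q, n). p < q})"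
  proof
    fix x assume "x \<in> {x. \<not> F differentiable (at x)}"
    then have nd: "\<not> F differentiable (at x)" by simp
    have "\<nexists>l. ((\<lambda>h. (G (x + h) - G x) / h) \<longlongrightarrow> l) (at 0)"
    proof
      assume "\<exists>l. ((\<lambda>h. (G (x + h) - G x) / h) \<longlongrightarrow> l) (at 0)"
      then obtain l where "(G has_field_derivative l) (at x)" by (auto simp: DERIV_def)
      then have "((\<lambda>x. G x - L * x) has_field_derivative (l - L)) (at x)"
        by (auto intro!: derivative_eq_intros)
      then show False using nd by (simp add: G_def real_differentiable_def)
    qed
    moreover have "\<bar>(G (x + h) - G x) / h\<bar> \<le> 2 * L" if "h \<noteq> 0" for h
    proof -
      have "\<bar>G (x + h) - G x\<bar> \<le> \<bar>F (x + h) - F x\<bar> + \<bar>L * h\<bar>" by (simp add: G_def algebra_simps)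
      also have "\<dots> \<le> 2 * L * \<bar>h\<bar>" using lipD[of "x + h" x] L0 by (simp add: abs_mult)
      finally show ?thesis using that by (simp add: divide_le_eq abs_divide)
    qed
    then have "eventually (\<lambda>h. \<bar>(G (x + h) - G x) / h\<bar> \<le> 2 * L) (at 0)"
      by (auto simp: eventually_at intro!: exI[of _ 1])
    ultimately obtain p q :: rat where pq: "p < q" "frequently (\<lambda>h. (G (x + h) - G x) / h < of_rat p) (at 0)"
      "frequently (\<lambda>h. of_rat q < (G (x + h) - G x) / h) (at 0)"
      using bounded_convergent_or_oscillates[of "at 0" "\<lambda>h. (G (x + h) - G x) / h" "2 * L"] by auto
    obtain n where "\<bar>x\<bar> < real n" using reals_Archimedean2 by blast
    then have "x \<in> S (p, q, n)" using pq by (simp add: S_def)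
    then show "x \<in> \<Union> (S ` {(p, q, n). p < q})" using pq by blast
  qed
  have "negligible (\<Union> (S ` {(p, q, n). p < q}))"
  proof (rule negligible_countable_Union)
    show "countable (S ` {(p, q, n). p < q})"
      by (rule countable_image) (rule countableI_type)
  qed (use negS in auto)
  then show ?thesis using sub negligible_subset by blast
qed

lemma lipschitz_ae_vector_derivative:
  fixes u :: "real \<Rightarrow> 'a::euclidean_space"
  assumes lip: "L-lipschitz_on {a..b} u"
  shows "negligible {t. a < t \<and> t < b \<and> (\<nexists>D. (u has_vector_derivative D) (at t))}"
proof (cases "a < b")
  case True
  \<comment> \<open>The constant extension beyond the end points is Lipschitz on the whole line.\<close>
  define clamp :: "real \<Rightarrow> real" where "clamp = (\<lambda>t. max a (min b t))"
  have clamp: "clamp t \<in> {a..b}" for t using True by (auto simp: clamp_def)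
  have lipc: "L-lipschitz_on UNIV (\<lambda>t. u (clamp t) \<bullet> i)" if i: "i \<in> Basis" for i
  proof (rule lipschitz_onI)
    show "0 \<le> L" using lip by (rule lipschitz_on_nonneg)
    fix s t :: real
    have "dist (u (clamp s) \<bullet> i) (u (clamp t) \<bullet> i) \<le> dist (u (clamp s)) (u (clamp t))"
      using Basis_le_norm[OF i, of "u (clamp s) - u (clamp t)"] by (simp add: dist_norm inner_diff_left)
    also have "\<dots> \<le> L * dist (clamp s) (clamp t)" by (intro lipschitz_onD[OF lip] clamp)
    also have "\<dots> \<le> L * dist s t"
      using \<open>0 \<le> L\<close> by (intro mult_left_mono) (auto simp: clamp_def dist_real_def)
    finally show "dist (u (clamp s) \<bullet> i) (u (clamp t) \<bullet> i) \<le> L * dist s t" .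
  qed
  have "{t. a < t \<and> t < b \<and> (\<nexists>D. (u has_vector_derivative D) (at t))}
    \<subseteq> (\<Union>i\<in>Basis. {t. \<not> (\<lambda>t. u (clamp t) \<bullet> i) differentiable (at t)})"
  proof (rule subsetI, rule ccontr)
    fix t assume t: "t \<in> {t. a < t \<and> t < b \<and> (\<nexists>D. (u has_vector_derivative D) (at t))}"
      and "t \<notin> (\<Union>i\<in>Basis. {t. \<not> (\<lambda>t. u (clamp t) \<bullet> i) differentiable (at t)})"
    then have "(\<lambda>t. u (clamp t)) differentiable (at t)"
      by (subst differentiable_componentwise_within) auto
    then obtain D where D: "((\<lambda>t. u (clamp t)) has_vector_derivative D) (at t)"
      by (metis vector_derivative_works)
    have "(u has_vector_derivative D) (at t)"
      by (rule has_vector_derivative_transform_within_open[OF D, of "{a<..<b}"])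
        (use t in \<open>auto simp: clamp_def\<close>)
    then show False using t by blast
  qed
  moreover have "negligible (\<Union>i\<in>(Basis::'a set). {t. \<not> (\<lambda>t. u (clamp t) \<bullet> i) differentiable (at t)})"
    by (intro negligible_Union finite_imageI) (auto intro: negligible_not_differentiable_real[OF lipc])
  ultimately show ?thesis using negligible_subset by blast
next
  case False
  then have "{t. a < t \<and> t < b \<and> (\<nexists>D. (u has_vector_derivative D) (at t))} = {}" by auto
  then show ?thesis by (metis negligible_empty)
qed

section \<open>Projected Euler scheme and the evolution variational inequality\<close>

text \<open>The drift \<open>V\<close> is any field of linear growth; no continuity is available for a selection of
  subgradients. All that survives the limit is the lower bound \<open>\<psi>\<close>, continuous in the state:
  for a saddle function \<open>\<psi> (y, \<mu>) (x, \<lambda>) = L x \<mu> - L y \<lambda>\<close>.\<close>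

locale projected_dynamics =
  fixes Z :: "'a::euclidean_space set" and V :: "'a \<Rightarrow> 'a" and \<psi> :: "'a \<Rightarrow> 'a \<Rightarrow> real"
    and C :: real and u0 :: 'a
  assumes closed_Z: "closed Z" and convex_Z: "convex Z" and u0: "u0 \<in> Z" and C: "0 \<le> C"
    and growth: "\<And>u. u \<in> Z \<Longrightarrow> norm (V u) \<le> C * (1 + norm u)"
    and dissipative: "\<And>u z. u \<in> Z \<Longrightarrow> z \<in> Z \<Longrightarrow> \<psi> z u \<le> V u \<bullet> (u - z)"
    and \<psi>_continuous: "\<And>z. z \<in> Z \<Longrightarrow> continuous_on Z (\<psi> z)"
begin

fun euler :: "real \<Rightarrow> nat \<Rightarrow> 'a" where
  "euler h 0 = u0"
| "euler h (Suc n) = closest_point Z (euler h n - h *\<^sub>R V (euler h n))"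

lemma euler_in: "euler h n \<in> Z"
proof (cases n)
  case (Suc m)
  have "Z \<noteq> {}" using u0 by blast
  then show ?thesis by (simp add: Suc closed_Z closest_point_in_set)
qed (simp add: u0)

lemma dist_euler_Suc:
  assumes "z \<in> Z"
  shows "norm (euler h (Suc n) - z) \<le> norm (euler h n - h *\<^sub>R V (euler h n) - z)"
proof -
  have "dist (closest_point Z (euler h n - h *\<^sub>R V (euler h n))) (closest_point Z z)
      \<le> dist (euler h n - h *\<^sub>R V (euler h n)) z"
    using assms by (intro closest_point_lipschitz convex_Z closed_Z) auto
  then show ?thesis using assms by (simp add: closest_point_self dist_norm)
qed

lemma euler_step:
  assumes "0 \<le> h"
  shows "norm (euler h (Suc n) - euler h n) \<le> h * C * (1 + norm (euler h n))"
proof -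
  have "norm (euler h (Suc n) - euler h n) \<le> h * norm (V (euler h n))"
    using dist_euler_Suc[OF euler_in, of h n h n] assms by simp
  also have "\<dots> \<le> h * (C * (1 + norm (euler h n)))"
    by (intro mult_left_mono growth euler_in assms)
  finally show ?thesis by (simp add: mult.assoc)
qed

lemma euler_growth:
  assumes "0 \<le> h"
  shows "1 + norm (euler h n) \<le> exp (C * (h * real n)) * (1 + norm u0)"
proof (induction n)
  case (Suc n)
  have "norm (euler h (Suc n)) \<le> norm (euler h n) + norm (euler h (Suc n) - euler h n)"
    by (metis add.commute diff_add_cancel norm_triangle_ineq)
  then have "1 + norm (euler h (Suc n)) \<le> (1 + h * C) * (1 + norm (euler h n))"
    using euler_step[OF assms, of n] by (simp add: algebra_simps)
  also have "\<dots> \<le> exp (h * C) * (exp (C * (h * real n)) * (1 + norm u0))"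
    using assms C by (intro mult_mono Suc exp_ge_add_one_self) auto
  also have "\<dots> = exp (C * (h * real (Suc n))) * (1 + norm u0)"
    by (simp add: algebra_simps exp_add)
  finally show ?case .
qed simp

text \<open>A bound for the drift along the scheme up to time \<open>T\<close>, uniform in the step size; it becomes
  the Lipschitz constant of the solution on \<open>[0, T]\<close>.\<close>

definition speed :: "real \<Rightarrow> real" where
  "speed T = C * (exp (C * T) * (1 + norm u0))"

lemma speed_nonneg: "0 \<le> speed T" unfolding speed_def using C by simp

lemma speed_bound:
  assumes "0 \<le> h" "h * real n \<le> T"
  shows "C * (1 + norm (euler h n)) \<le> speed T"
proof -
  have "C * (1 + norm (euler h n)) \<le> C * (exp (C * (h * real n)) * (1 + norm u0))"
    by (intro mult_left_mono euler_growth assms C)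
  also have "\<dots> \<le> speed T" unfolding speed_def
    using mult_left_mono[OF assms(2) C] C by (intro mult_left_mono mult_right_mono) auto
  finally show ?thesis .
qed

lemma euler_lipschitz:
  assumes h: "0 \<le> h" and "a \<le> b" "h * real b \<le> T"
  shows "norm (euler h b - euler h a) \<le> h * real (b - a) * speed T"
  using assms(2,3)
proof (induction b rule: dec_induct)
  case (step n)
  have nT: "h * real n \<le> T" using step.prems h by (smt (verit) mult_left_mono of_nat_Suc)
  have "norm (euler h (Suc n) - euler h a) \<le> norm (euler h (Suc n) - euler h n) + norm (euler h n - euler h a)"
    by (metis diff_add_cancel add_diff_eq norm_triangle_ineq)
  also have "\<dots> \<le> h * speed T + h * real (n - a) * speed T"
  proof (intro add_mono)
    have "norm (euler h (Suc n) - euler h n) \<le> h * (C * (1 + norm (euler h n)))"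
      using euler_step[OF h, of n] by (simp add: mult.assoc)
    also have "\<dots> \<le> h * speed T" by (intro mult_left_mono speed_bound h nT)
    finally show "norm (euler h (Suc n) - euler h n) \<le> h * speed T" .
    show "norm (euler h n - euler h a) \<le> h * real (n - a) * speed T"
      by (rule step.IH[OF nT])
  qed
  also have "\<dots> = h * real (Suc n - a) * speed T"
    using step.hyps by (simp add: of_nat_diff algebra_simps)
  finally show ?case .
qed simp

text \<open>Expand the square after dropping the projection, which does not increase the distance to a
  point of \<open>Z\<close>. The quadratic error term is summable to \<open>O(h)\<close> over bounded times.\<close>

lemma euler_energy_step:
  assumes h: "0 \<le> h" and z: "z \<in> Z" and c: "c \<le> \<psi> z (euler h n)" and T: "h * real n \<le> T"
  shows "(norm (euler h (Suc n) - z))\<^sup>2 \<le> (norm (euler h n - z))\<^sup>2 - 2 * h * c + (h * speed T)\<^sup>2"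
proof -
  let ?u = "euler h n"
  have "(norm (euler h (Suc n) - z))\<^sup>2 \<le> (norm (?u - h *\<^sub>R V ?u - z))\<^sup>2"
    by (intro power_mono dist_euler_Suc z) simp
  also have "\<dots> = (norm (?u - z))\<^sup>2 - 2 * h * (V ?u \<bullet> (?u - z)) + (h * norm (V ?u))\<^sup>2"
  proof -
    have "(norm (w - h *\<^sub>R v))\<^sup>2 = (norm w)\<^sup>2 - 2 * h * (v \<bullet> w) + (h * norm v)\<^sup>2" for v w :: 'a
      by (simp add: power2_norm_eq_inner power_mult_distrib inner_diff_left inner_diff_right
          inner_commute[of w v] power2_eq_square[of h] right_diff_distrib)
    from this[of "?u - z" "V ?u"] show ?thesis by (simp add: algebra_simps)
  qed
  also have "h * c \<le> h * (V ?u \<bullet> (?u - z))"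
    using dissipative[OF euler_in z, of h n] c by (intro mult_left_mono h) linarith
  moreover have "(h * norm (V ?u))\<^sup>2 \<le> (h * speed T)\<^sup>2"
  proof (intro power_mono mult_left_mono h)
    show "norm (V ?u) \<le> speed T" using growth[OF euler_in, of h n] speed_bound[OF h T] by linarith
  qed (use h in auto)
  ultimately show ?thesis by (simp add: mult.assoc)
qed

lemma euler_energy:
  assumes h: "0 \<le> h" and z: "z \<in> Z" and "a \<le> b" "h * real b \<le> T"
    and c: "\<And>n. a \<le> n \<Longrightarrow> n < b \<Longrightarrow> c \<le> \<psi> z (euler h n)"
  shows "(norm (euler h b - z))\<^sup>2 \<le> (norm (euler h a - z))\<^sup>2 - 2 * (h * real (b - a)) * c
     + h * (h * real (b - a)) * (speed T)\<^sup>2"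
  using assms(3-5)
proof (induction b rule: dec_induct)
  case (step n)
  have nT: "h * real n \<le> T" using step.prems h by (smt (verit) mult_left_mono of_nat_Suc)
  have cn: "c \<le> \<psi> z (euler h n)" using step by auto
  have "(norm (euler h n - z))\<^sup>2 \<le> (norm (euler h a - z))\<^sup>2 - 2 * (h * real (n - a)) * c
     + h * (h * real (n - a)) * (speed T)\<^sup>2"
    using step.prems by (intro step.IH nT) auto
  moreover have "real (Suc n - a) = real (n - a) + 1" using step.hyps by (simp add: Suc_diff_le)
  ultimately show ?case using euler_energy_step[OF h z cn nT]
    by (simp add: algebra_simps power2_eq_square)
qed simp

text \<open>Piecewise constant interpolation in time. It is Lipschitz only up to an error of the order of the
  mesh, which is harmless in the limit and avoids polygonal interpolation.\<close>

definition mesh :: "nat \<Rightarrow> real" where "mesh m = 1 / (real m + 1)"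

definition index :: "nat \<Rightarrow> real \<Rightarrow> nat" where "index m t = nat \<lfloor>t / mesh m\<rfloor>"

definition approx :: "nat \<Rightarrow> real \<Rightarrow> 'a" where "approx m t = euler (mesh m) (index m t)"

lemma mesh_pos: "0 < mesh m" by (simp add: mesh_def)

lemma mesh_tendsto: "mesh \<longlonglongrightarrow> 0"
  unfolding mesh_def using LIMSEQ_inverse_real_of_nat by (simp add: inverse_eq_divide add.commute)

lemma index_bounds:
  assumes "0 \<le> t"
  shows "mesh m * real (index m t) \<le> t" "t - mesh m \<le> mesh m * real (index m t)"
proof -
  have "real (index m t) = of_int \<lfloor>t / mesh m\<rfloor>"
    using assms mesh_pos[of m] by (simp add: index_def)
  then have "real (index m t) \<le> t / mesh m" "t / mesh m - 1 \<le> real (index m t)" by linarith+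
  then show "mesh m * real (index m t) \<le> t" "t - mesh m \<le> mesh m * real (index m t)"
    using mesh_pos[of m] by (simp_all add: field_simps)
qed

lemma index_mono: "s \<le> t \<Longrightarrow> index m s \<le> index m t"
  unfolding index_def using mesh_pos[of m] by (intro nat_mono floor_mono divide_right_mono) auto

lemma index_diff:
  assumes "0 \<le> s" "s \<le> t"
  shows "\<bar>mesh m * real (index m t - index m s) - (t - s)\<bar> \<le> mesh m"
  using index_bounds[of s m] index_bounds[of t m] index_mono[of s t m] assms
  by (simp add: of_nat_diff algebra_simps abs_le_iff)

lemma approx_in: "approx m t \<in> Z" by (simp add: approx_def euler_in)

lemma approx_lipschitz:
  assumes "0 \<le> s" "s \<le> t" "t \<le> T"
  shows "norm (approx m t - approx m s) \<le> (t - s + mesh m) * speed T"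
proof -
  have "norm (approx m t - approx m s) \<le> mesh m * real (index m t - index m s) * speed T"
    unfolding approx_def
    using mesh_pos[of m] index_bounds[of t m] assms by (intro euler_lipschitz index_mono) auto
  also have "\<dots> \<le> (t - s + mesh m) * speed T"
    using index_diff[of s t m] assms by (intro mult_right_mono speed_nonneg) auto
  finally show ?thesis .
qed

text \<open>The exponential weight gives a bound uniform over all times, so that one extraction of a
  subsequence serves the whole half-line.\<close>

lemma approx_bounded:
  assumes "0 \<le> t"
  shows "norm (exp (- (C * t)) *\<^sub>R approx m t) \<le> 1 + norm u0"
proof -
  have "norm (approx m t) \<le> exp (C * (mesh m * real (index m t))) * (1 + norm u0)"
    using euler_growth[of "mesh m" "index m t"] mesh_pos[of m] by (simp add: approx_def)
  also have "\<dots> \<le> exp (C * t) * (1 + norm u0)"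
    using index_bounds(1)[OF assms, of m] C by (intro mult_right_mono) (auto intro: mult_left_mono)
  finally have "exp (- (C * t)) * norm (approx m t) \<le> exp (- (C * t)) * (exp (C * t) * (1 + norm u0))"
    by (intro mult_left_mono) auto
  then show ?thesis by (simp add: exp_minus field_simps)
qed

text \<open>A diagonal subsequence converges at the rational times, and the asymptotic Lipschitz bound
  carries convergence to all times.\<close>

lemma approx_convergent_subsequence:
  obtains k u where "strict_mono (k :: nat \<Rightarrow> nat)" "\<And>t. 0 \<le> t \<Longrightarrow> (\<lambda>m. approx (k m) t) \<longlonglongrightarrow> u t"
proof -
  obtain k :: "nat \<Rightarrow> nat" where k: "strict_mono k"
    and lim: "\<And>x. x \<in> \<rat> \<inter> {0..} \<Longrightarrow> \<exists>l. (\<lambda>m. exp (- (C * x)) *\<^sub>R approx (k m) x) \<longlonglongrightarrow> l"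
  proof (rule function_convergent_subsequence[of "\<rat> \<inter> {0..}" "\<lambda>m t. exp (- (C * t)) *\<^sub>R approx m t" "1 + norm u0"])
    show "countable (\<rat> \<inter> {0::real..})" by (simp add: countable_rat countable_Int1)
  qed (use approx_bounded in auto)
  have mesh_k: "(\<lambda>m. mesh (k m)) \<longlonglongrightarrow> 0"
    using LIMSEQ_subseq_LIMSEQ[OF mesh_tendsto k] by (simp add: o_def)
  have "\<exists>l. (\<lambda>m. approx (k m) t) \<longlonglongrightarrow> l" if t: "0 \<le> t" for t
  proof -
    have "Cauchy (\<lambda>m. approx (k m) t)"
    proof (rule metric_CauchyI)
      fix e :: real assume e: "e > 0"
      define R where "R = speed (t + 1) + 1"
      have R: "R > 0" "speed (t + 1) \<le> R" using speed_nonneg[of "t + 1"] by (auto simp: R_def)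
      define d where "d = min 1 (e / (6 * R))"
      have d: "d > 0" "d \<le> 1" "d * R \<le> e / 6" using e R by (auto simp: d_def min_def field_simps)
      obtain q where q: "q \<in> \<rat>" "t < q" "q < t + d" using d Rats_dense_in_real[of t "t + d"] by auto
      obtain l where l: "(\<lambda>m. exp (- (C * q)) *\<^sub>R approx (k m) q) \<longlonglongrightarrow> l" using lim[of q] q t by auto
      have "(\<lambda>m. approx (k m) q) \<longlonglongrightarrow> exp (C * q) *\<^sub>R l"
        using tendsto_scaleR[OF tendsto_const l, of "exp (C * q)"] by (simp flip: exp_add)
      then have "Cauchy (\<lambda>m. approx (k m) q)" by (rule LIMSEQ_imp_Cauchy)
      then obtain M1 where M1: "\<And>m n. m \<ge> M1 \<Longrightarrow> n \<ge> M1 \<Longrightarrow> dist (approx (k m) q) (approx (k n) q) < e / 6"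
        using metric_CauchyD[of "\<lambda>m. approx (k m) q" "e / 6"] e by fastforce
      obtain M2 where M2: "\<And>m. m \<ge> M2 \<Longrightarrow> mesh (k m) < d"
        using order_tendstoD(2)[OF mesh_k d(1)] by (auto simp: eventually_sequentially)
      have near: "dist (approx (k m) t) (approx (k m) q) \<le> e / 3" if "m \<ge> M2" for m
      proof -
        have "dist (approx (k m) t) (approx (k m) q) \<le> (q - t + mesh (k m)) * speed (t + 1)"
          using approx_lipschitz[of t q "t + 1" "k m"] q d t by (simp add: dist_norm norm_minus_commute)
        also have "\<dots> \<le> (2 * d) * R"
          using q M2[OF that] R d speed_nonneg mesh_pos[of "k m"] by (intro mult_mono) auto
        finally show ?thesis using d by simp
      qed
      show "\<exists>M. \<forall>m\<ge>M. \<forall>n\<ge>M. dist (approx (k m) t) (approx (k n) t) < e"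
      proof (intro exI allI impI)
        fix m n assume mn: "max M1 M2 \<le> m" "max M1 M2 \<le> n"
        show "dist (approx (k m) t) (approx (k n) t) < e"
          using near[of m] near[of n] M1[of m n] mn e
            dist_triangle[of "approx (k m) t" "approx (k n) t" "approx (k m) q"]
            dist_triangle[of "approx (k m) q" "approx (k n) t" "approx (k n) q"]
          by (simp add: dist_commute)
      qed
    qed
    then show ?thesis by (simp add: Cauchy_convergent_iff convergent_def)
  qed
  then obtain u where "\<And>t. 0 \<le> t \<Longrightarrow> (\<lambda>m. approx (k m) t) \<longlonglongrightarrow> u t" by metis
  with k that show ?thesis by blast
qed

text \<open>Near time \<open>t\<close> all Euler iterates stay close to \<open>u t\<close>, where \<open>\<psi> z\<close> exceeds any \<open>c < \<psi> z (u t)\<close>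
  by continuity. So the squared distance to \<open>z\<close> decreases at rate at least \<open>2 c\<close> just after \<open>t\<close>,
  first for the iterates and then for the limit.\<close>

lemma evolution_variational_inequality:
  obtains u where "u 0 = u0" "\<And>t. 0 \<le> t \<Longrightarrow> u t \<in> Z"
    "\<And>T. (speed T)-lipschitz_on {0..T} u"
    "\<And>t z D. 0 \<le> t \<Longrightarrow> z \<in> Z \<Longrightarrow> (u has_vector_derivative D) (at t) \<Longrightarrow> \<psi> z (u t) \<le> - D \<bullet> (u t - z)"
proof -
  obtain k u where k: "strict_mono (k :: nat \<Rightarrow> nat)"
    and lim: "\<And>t. 0 \<le> t \<Longrightarrow> (\<lambda>m. approx (k m) t) \<longlonglongrightarrow> u t"
    using approx_convergent_subsequence by blast
  have mesh_k: "(\<lambda>m. mesh (k m)) \<longlonglongrightarrow> 0"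
    using LIMSEQ_subseq_LIMSEQ[OF mesh_tendsto k] by (simp add: o_def)
  have uZ: "u t \<in> Z" if "0 \<le> t" for t
    using closed_sequentially[OF closed_Z _ lim[OF that]] approx_in by blast
  show ?thesis
  proof
    show "u 0 = u0" using lim[of 0] by (simp add: approx_def index_def LIMSEQ_const_iff)
    show "u t \<in> Z" if "0 \<le> t" for t by (rule uZ[OF that])
    have lip: "norm (u t - u s) \<le> (t - s) * speed T" if "0 \<le> s" "s \<le> t" "t \<le> T" for s t T
    proof (rule LIMSEQ_le)
      show "(\<lambda>m. norm (approx (k m) t - approx (k m) s)) \<longlonglongrightarrow> norm (u t - u s)"
        using that by (intro tendsto_intros lim) auto
      show "(\<lambda>m. (t - s + mesh (k m)) * speed T) \<longlonglongrightarrow> (t - s) * speed T"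
        using tendsto_mult[OF tendsto_add[OF tendsto_const mesh_k] tendsto_const] by simp
    qed (use approx_lipschitz[OF that] in blast)
    show "(speed T)-lipschitz_on {0..T} u" for T
    proof (rule lipschitz_onI)
      fix s t assume "s \<in> {0..T}" "t \<in> {0..T}"
      then show "dist (u s) (u t) \<le> speed T * dist s t"
        using lip[of s t T] lip[of t s T]
        by (cases "s \<le> t") (auto simp: dist_norm norm_minus_commute mult.commute)
    qed (rule speed_nonneg)
    fix t z D assume t: "0 \<le> t" and z: "z \<in> Z" and D: "(u has_vector_derivative D) (at t)"
    show "\<psi> z (u t) \<le> - D \<bullet> (u t - z)"
    proof (rule dense_le)
      fix c assume c: "c < \<psi> z (u t)"
      have "\<forall>\<^sub>F w in at (u t) within Z. c < \<psi> z w"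
        using \<psi>_continuous[OF z] uZ[OF t] c by (auto simp: continuous_on_def intro: order_tendstoD)
      then obtain \<eta> where \<eta>: "\<eta> > 0" "\<And>w. w \<in> Z \<Longrightarrow> dist w (u t) < \<eta> \<Longrightarrow> c < \<psi> z w"
        using c unfolding eventually_at by (metis)
      define R where "R = speed (t + 1) + 1"
      have R: "R > 0" "speed (t + 1) \<le> R" using speed_nonneg[of "t + 1"] by (auto simp: R_def)
      define d where "d = min 1 (\<eta> / (3 * R))"
      have d: "d > 0" "d \<le> 1" "d * R \<le> \<eta> / 3" using \<eta> R by (auto simp: d_def min_def field_simps)
      have decay: "(norm (u s - z))\<^sup>2 \<le> (norm (u t - z))\<^sup>2 - 2 * (s - t) * c" if s: "t < s" "s < t + d" for s
      proof (rule LIMSEQ_le)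
        let ?N = "\<lambda>m. index (k m) s - index (k m) t"
        have N: "(\<lambda>m. mesh (k m) * real (?N m)) \<longlonglongrightarrow> s - t"
        proof (rule Lim_transform2[OF tendsto_const])
          show "(\<lambda>m. (s - t) - mesh (k m) * real (?N m)) \<longlonglongrightarrow> 0"
          proof (rule Lim_null_comparison[OF _ mesh_k])
            show "\<forall>\<^sub>F m in sequentially. norm ((s - t) - mesh (k m) * real (?N m)) \<le> mesh (k m)"
              using index_diff[of t s] t s by (auto simp: abs_minus_commute)
          qed
        qed
        show "(\<lambda>m. (norm (approx (k m) s - z))\<^sup>2) \<longlonglongrightarrow> (norm (u s - z))\<^sup>2"
          using s t by (intro tendsto_intros lim) auto
        have "(\<lambda>m. (norm (approx (k m) t - z))\<^sup>2 - 2 * (mesh (k m) * real (?N m)) * c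
            + mesh (k m) * (mesh (k m) * real (?N m)) * (speed (t + 1))\<^sup>2)
          \<longlonglongrightarrow> (norm (u t - z))\<^sup>2 - 2 * (s - t) * c + 0 * (s - t) * (speed (t + 1))\<^sup>2"
          using t by (intro tendsto_intros lim N mesh_k) auto
        then show "(\<lambda>m. (norm (approx (k m) t - z))\<^sup>2 - 2 * (mesh (k m) * real (?N m)) * c
            + mesh (k m) * (mesh (k m) * real (?N m)) * (speed (t + 1))\<^sup>2)
          \<longlonglongrightarrow> (norm (u t - z))\<^sup>2 - 2 * (s - t) * c" by simp
        have "\<forall>\<^sub>F m in sequentially. dist (approx (k m) t) (u t) < \<eta> / 3"
          using tendstoD[OF lim[OF t], of "\<eta> / 3"] \<eta> by simp
        moreover have "\<forall>\<^sub>F m in sequentially. mesh (k m) < d"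
          by (rule order_tendstoD(2)[OF mesh_k d(1)])
        ultimately have "\<forall>\<^sub>F m in sequentially. (norm (approx (k m) s - z))\<^sup>2
            \<le> (norm (approx (k m) t - z))\<^sup>2 - 2 * (mesh (k m) * real (?N m)) * c
            + mesh (k m) * (mesh (k m) * real (?N m)) * (speed (t + 1))\<^sup>2"
        proof eventually_elim
          case (elim m)
          show ?case unfolding approx_def
          proof (rule euler_energy)
            have sT: "mesh (k m) * real (index (k m) s) \<le> t + 1"
              using index_bounds(1)[of s "k m"] s t d by linarith
            then show "mesh (k m) * real (index (k m) s) \<le> t + 1" .
            fix n assume n: "index (k m) t \<le> n" "n < index (k m) s"
            have "mesh (k m) * real n \<le> mesh (k m) * real (index (k m) s)"
              using n mesh_pos[of "k m"] by (intro mult_left_mono) auto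
            with sT have nT: "mesh (k m) * real n \<le> t + 1" by linarith
            have "norm (euler (mesh (k m)) n - approx (k m) t)
              \<le> mesh (k m) * real (n - index (k m) t) * speed (t + 1)"
              unfolding approx_def using mesh_pos[of "k m"] n nT by (intro euler_lipschitz) auto
            also have "\<dots> \<le> mesh (k m) * real (?N m) * speed (t + 1)"
              using n mesh_pos[of "k m"] by (intro mult_right_mono mult_left_mono speed_nonneg) auto
            also have "\<dots> \<le> (2 * d) * R"
            proof (rule mult_mono[OF _ R(2)])
              show "mesh (k m) * real (?N m) \<le> 2 * d"
                using index_diff[of t s "k m"] t s elim by (simp add: abs_le_iff)
            qed (use d speed_nonneg in auto)
            finally have "dist (euler (mesh (k m)) n) (approx (k m) t) \<le> 2 * (\<eta> / 3)"
              using d by (simp add: dist_norm)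
            then have "dist (euler (mesh (k m)) n) (u t) < \<eta>"
              using elim dist_triangle[of "euler (mesh (k m)) n" "u t" "approx (k m) t"] by linarith
            then show "c \<le> \<psi> z (euler (mesh (k m)) n)" using \<eta>(2)[OF euler_in] by (simp add: less_imp_le)
          qed (use mesh_pos[of "k m"] z s index_mono[of t s "k m"] in auto)
        qed
        then show "\<exists>N. \<forall>m\<ge>N. (norm (approx (k m) s - z))\<^sup>2
            \<le> (norm (approx (k m) t - z))\<^sup>2 - 2 * (mesh (k m) * real (?N m)) * c
            + mesh (k m) * (mesh (k m) * real (?N m)) * (speed (t + 1))\<^sup>2"
          by (simp add: eventually_sequentially)
      qed
      have "((\<lambda>s. (u s - z) \<bullet> (u s - z)) has_vector_derivative (2 * (D \<bullet> (u t - z)))) (at t)"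
        using D unfolding has_vector_derivative_def
        by (auto intro!: derivative_eq_intros simp: fun_eq_iff inner_commute algebra_simps)
      then have der: "((\<lambda>s. (norm (u s - z))\<^sup>2 + 2 * (s - t) * c) has_real_derivative
          2 * (D \<bullet> (u t - z)) + 2 * c) (at t)"
        unfolding has_real_derivative_iff_has_vector_derivative[symmetric] power2_norm_eq_inner
        by (auto intro!: derivative_eq_intros)
      have "2 * (D \<bullet> (u t - z)) + 2 * c \<le> 0"
      proof (rule ccontr)
        assume pos: "\<not> ?thesis"
        obtain e where e: "e > 0" "\<And>h. 0 < h \<Longrightarrow> h < e \<Longrightarrow>
            (norm (u t - z))\<^sup>2 + 2 * (t - t) * c < (norm (u (t + h) - z))\<^sup>2 + 2 * (t + h - t) * c"
          using DERIV_pos_inc_right[OF der] pos by auto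
        define h where "h = min e d / 2"
        have "0 < h" "h < e" "h < d" using e d by (auto simp: h_def)
        with e(2)[of h] decay[of "t + h"] show False by simp
      qed
      then show "c \<le> - D \<bullet> (u t - z)" by simp
    qed
  qed
qed

end

section \<open>Velocities of constrained curves as projected subgradients\<close>

text \<open>The subdifferential sum rule for a convex function and the indicator of \<open>W\<close>: separate the
  strict epigraph \<open>S\<close> of \<open>h\<close> over \<open>D\<close> from the part \<open>T\<close> over \<open>W\<close> lying below the affine minorant
  given by \<open>v\<close>. Openness of \<open>D\<close> prevents the separating hyperplane from being vertical, and its
  slope is the subgradient.\<close>

lemma subgradient_of_constrained:
  fixes h :: "'a::euclidean_space \<Rightarrow> real"
  assumes D: "open D" and h: "convex_on D h" and W: "convex W" "W \<subseteq> D" and x: "x \<in> W"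
    and v: "\<And>y. y \<in> W \<Longrightarrow> h x + v \<bullet> (y - x) \<le> h y"
  obtains p where "p \<in> subdifferential D h x" "\<And>y. y \<in> W \<Longrightarrow> (v - p) \<bullet> (y - x) \<le> 0"
proof -
  define S where "S = {(y, r). y \<in> D \<and> h y < r}"
  define T where "T = {(y, r). y \<in> W \<and> r \<le> h x + v \<bullet> (y - x)}"
  have cD: "convex D" using h by (rule convex_on_imp_convex)
  have xD: "x \<in> D" using x W by auto
  have "convex S"
  proof (rule convexI)
    fix P Q :: "'a \<times> real" and a b :: real
    assume *: "P \<in> S" "Q \<in> S" "0 \<le> a" "0 \<le> b" "a + b = 1"
    obtain y r z s where PQ: "P = (y, r)" "Q = (z, s)" by (metis surj_pair)
    have yz: "y \<in> D" "z \<in> D" "h y < r" "h z < s" using * PQ by (auto simp: S_def)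
    have "h (a *\<^sub>R y + b *\<^sub>R z) \<le> a * h y + b * h z" using h yz * unfolding convex_on_def by blast
    also have "\<dots> < a * r + b * s"
    proof (cases "a = 0")
      case False
      then show ?thesis using yz * by (intro add_less_le_mono mult_strict_left_mono mult_left_mono) auto
    qed (use yz * in auto)
    finally show "a *\<^sub>R P + b *\<^sub>R Q \<in> S" using convexD[OF cD] yz * PQ by (simp add: S_def)
  qed
  moreover have "convex T"
  proof (rule convexI)
    fix P Q :: "'a \<times> real" and a b :: real
    assume *: "P \<in> T" "Q \<in> T" "0 \<le> a" "0 \<le> b" "a + b = 1"
    obtain y r z s where PQ: "P = (y, r)" "Q = (z, s)" by (metis surj_pair)
    have yz: "y \<in> W" "z \<in> W" "r \<le> h x + v \<bullet> (y - x)" "s \<le> h x + v \<bullet> (z - x)" using * PQ by (auto simp: T_def)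
    have "a * r + b * s \<le> a * (h x + v \<bullet> (y - x)) + b * (h x + v \<bullet> (z - x))"
      using yz * by (intro add_mono mult_left_mono) auto
    also have "\<dots> = (a + b) * (h x - v \<bullet> x) + v \<bullet> (a *\<^sub>R y + b *\<^sub>R z)" by (simp add: algebra_simps)
    finally show "a *\<^sub>R P + b *\<^sub>R Q \<in> T" using convexD[OF W(1)] yz * PQ by (simp add: T_def inner_diff_right)
  qed
  moreover have "(x, h x + 1) \<in> S" "(x, h x) \<in> T" using x xD by (auto simp: S_def T_def)
  moreover have "S \<inter> T = {}" using v by (force simp: S_def T_def)
  ultimately obtain ab d where ab: "ab \<noteq> 0" "\<And>z. z \<in> S \<Longrightarrow> ab \<bullet> z \<le> d" "\<And>z. z \<in> T \<Longrightarrow> d \<le> ab \<bullet> z"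
    using separating_hyperplane_sets[of S T] by (metis empty_iff)
  obtain c \<gamma> where c: "ab = (c, \<gamma>)" by (cases ab)
  have S: "c \<bullet> y + \<gamma> * r \<le> d" if "y \<in> D" "h y < r" for y r using ab(2)[of "(y, r)"] that c by (simp add: S_def)
  have T: "d \<le> c \<bullet> y + \<gamma> * r" if "y \<in> W" "r \<le> h x + v \<bullet> (y - x)" for y r
    using ab(3)[of "(y, r)"] that c by (simp add: T_def)
  have Tx: "d \<le> c \<bullet> x + \<gamma> * h x" using T[OF x, of "h x"] by simp
  \<comment> \<open>\<open>\<gamma> = 0\<close> would be a vertical hyperplane supporting \<open>D\<close> at its interior point \<open>x\<close>.\<close>
  have "\<gamma> \<le> 0" using S[OF xD, of "h x + 1"] Tx by (simp add: distrib_left)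
  moreover have "\<gamma> \<noteq> 0"
  proof
    assume 0: "\<gamma> = 0"
    have le: "c \<bullet> y \<le> c \<bullet> x" if "y \<in> D" for y using S[OF that, of "h y + 1"] Tx 0 by simp
    obtain e where e: "e > 0" "cball x e \<subseteq> D" using D xD open_contains_cball by blast
    have c0: "c \<noteq> 0" using ab(1) c 0 by (auto simp: zero_prod_def)
    have "x + (e / norm c) *\<^sub>R c \<in> D" using e c0 by (intro subsetD[OF e(2)]) (simp add: dist_norm)
    from le[OF this] have "(e / norm c) * (c \<bullet> c) \<le> 0" by (simp add: inner_add_right)
    moreover have "0 < (e / norm c) * (c \<bullet> c)" using e c0 by simp
    ultimately show False by linarith
  qed
  ultimately have \<gamma>: "\<gamma> < 0" by simp
  have S': "c \<bullet> y + \<gamma> * h y \<le> d" if y: "y \<in> D" for y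
  proof (rule field_le_epsilon)
    fix e :: real assume "e > 0"
    then show "c \<bullet> y + \<gamma> * h y \<le> d + e"
      using S[OF y, of "h y - e / \<gamma>"] \<gamma> by (simp add: right_diff_distrib divide_less_0_iff)
  qed
  define p where "p = c /\<^sub>R (- \<gamma>)"
  have p: "c = (- \<gamma>) *\<^sub>R p" using \<gamma> by (simp add: p_def)
  show ?thesis
  proof
    show "p \<in> subdifferential D h x" unfolding subdifferential_def
    proof (intro CollectI ballI)
      fix y assume "y \<in> D"
      then have "(- \<gamma>) * (p \<bullet> y - h y) \<le> (- \<gamma>) * (p \<bullet> x - h x)"
        using S'[of y] Tx by (simp add: p algebra_simps)
      then show "h x + p \<bullet> (y - x) \<le> h y" using \<gamma> by (simp add: inner_diff_right)
    qed
    fix y assume y: "y \<in> W"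
    have "(- \<gamma>) * (p \<bullet> x - h x) \<le> (- \<gamma>) * (p \<bullet> y - (h x + v \<bullet> (y - x)))"
      using T[OF y order_refl] S'[OF xD] by (simp add: p algebra_simps)
    then have "p \<bullet> x - h x \<le> p \<bullet> y - (h x + v \<bullet> (y - x))" using \<gamma> by simp
    then show "(v - p) \<bullet> (y - x) \<le> 0" by (simp add: inner_diff_left inner_diff_right)
  qed
qed

lemma subdifferential_nonempty:
  fixes h :: "'a::euclidean_space \<Rightarrow> real"
  assumes "open D" "convex_on D h" "x \<in> D"
  shows "subdifferential D h x \<noteq> {}"
  using subgradient_of_constrained[of D h "{x}" x 0] assms by auto

lemma normal_tangent_le:
  fixes n :: "'a::euclidean_space"
  assumes n: "\<And>y. y \<in> W \<Longrightarrow> n \<bullet> (y - x) \<le> 0" and w: "w \<in> tangent_cone W x"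
  shows "n \<bullet> w \<le> 0"
proof -
  obtain X and t :: "nat \<Rightarrow> real" where X: "\<And>k. X k \<in> W" "\<And>k. 0 < t k"
    "(\<lambda>k. (X k - x) /\<^sub>R t k) \<longlonglongrightarrow> w"
    using w unfolding tangent_cone_def by blast
  have "(\<lambda>k. n \<bullet> ((X k - x) /\<^sub>R t k)) \<longlonglongrightarrow> n \<bullet> w" by (intro tendsto_intros X)
  moreover have "n \<bullet> ((X k - x) /\<^sub>R t k) \<le> 0" for k
    using n[OF X(1), of k] X(2)[of k] by (simp add: divide_le_0_iff mult_le_0_iff)
  ultimately show ?thesis using LIMSEQ_le_const2 by blast
qed

text \<open>One half of Moreau's decomposition: a tangent vector plus an orthogonal normal vector projects
  to the tangent vector. By Pythagoras any other tangent vector is strictly farther away.\<close>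

lemma proj_tangent_eqI:
  fixes D :: "'a::euclidean_space"
  assumes D: "D \<in> tangent_cone W x" and n: "\<And>y. y \<in> W \<Longrightarrow> n \<bullet> (y - x) \<le> 0" and orth: "n \<bullet> D = 0"
  shows "proj_tangent W x (D + n) = D"
proof -
  have pyth: "(dist (D + n) D)\<^sup>2 + (norm (D - w))\<^sup>2 \<le> (dist (D + n) w)\<^sup>2" if "w \<in> tangent_cone W x" for w
  proof -
    have "(norm (D + n - w))\<^sup>2 = (norm (D - w))\<^sup>2 + (norm n)\<^sup>2 + 2 * (n \<bullet> (D - w))"
      by (simp add: power2_norm_eq_inner inner_commute algebra_simps)
    moreover have "n \<bullet> (D - w) \<ge> 0" using normal_tangent_le[OF n that] orth by (simp add: inner_diff_right)
    ultimately show ?thesis by (simp add: dist_norm)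
  qed
  have le: "dist (D + n) D \<le> dist (D + n) w" if "w \<in> tangent_cone W x" for w
    by (rule power2_le_imp_le) (use pyth[OF that] zero_le_power2[of "norm (D - w)"] in linarith, simp)
  show ?thesis unfolding proj_tangent_def closest_point_def
  proof (rule some_equality)
    fix w assume w: "w \<in> tangent_cone W x \<and> (\<forall>y\<in>tangent_cone W x. dist (D + n) w \<le> dist (D + n) y)"
    then have "dist (D + n) w \<le> dist (D + n) D" using D by blast
    then have "(dist (D + n) w)\<^sup>2 \<le> (dist (D + n) D)\<^sup>2" by (intro power_mono) auto
    then have "(norm (D - w))\<^sup>2 \<le> 0" using pyth[of w] w by linarith
    then show "w = D" by simp
  qed (use D le in blast)
qed

lemma derivative_in_tangent_cone:
  assumes t: "0 \<le> t" and uW: "\<And>s. 0 \<le> s \<Longrightarrow> u s \<in> W" and D: "(u has_vector_derivative D) (at t)"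
  shows "D \<in> tangent_cone W (u t)"
proof -
  define \<delta> where "\<delta> = (\<lambda>k. 1 / (real k + 1))"
  have \<delta>: "\<delta> \<longlonglongrightarrow> 0" "0 < \<delta> k" for k
    unfolding \<delta>_def using LIMSEQ_inverse_real_of_nat by (simp_all add: inverse_eq_divide add.commute)
  have "((\<lambda>h. (u (t + h) - u t) /\<^sub>R h) \<longlongrightarrow> D) (at 0)"
  proof (rule LIM_zero_cancel, rule Lim_null_comparison)
    show "((\<lambda>h. norm (u (t + h) - u t - h *\<^sub>R D) / norm h) \<longlongrightarrow> 0) (at 0)"
      using D by (simp add: has_vector_derivative_def has_derivative_at)
    have "norm ((u (t + h) - u t) /\<^sub>R h - D) = norm (u (t + h) - u t - h *\<^sub>R D) / norm h" if "h \<noteq> 0" for h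
    proof -
      have "(u (t + h) - u t) /\<^sub>R h - D = (u (t + h) - u t - h *\<^sub>R D) /\<^sub>R h"
        using that by (simp add: scaleR_diff_right)
      then show ?thesis by (simp add: divide_inverse_commute)
    qed
    then show "\<forall>\<^sub>F h in at 0. norm ((u (t + h) - u t) /\<^sub>R h - D) \<le> norm (u (t + h) - u t - h *\<^sub>R D) / norm h"
      by (auto simp: eventually_at intro!: exI[of _ 1])
  qed
  moreover have "filterlim \<delta> (at 0) sequentially"
    using \<delta> by (auto simp: filterlim_at eventually_sequentially less_imp_neq[symmetric])
  ultimately have quot: "(\<lambda>k. (u (t + \<delta> k) - u t) /\<^sub>R \<delta> k) \<longlonglongrightarrow> D"
    by (rule filterlim_compose)
  have "isCont u t" using D by (rule has_vector_derivative_continuous)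
  moreover have "(\<lambda>k. t + \<delta> k) \<longlonglongrightarrow> t" using tendsto_add[OF tendsto_const \<delta>(1), of t] by simp
  ultimately have "(\<lambda>k. u (t + \<delta> k)) \<longlonglongrightarrow> u t" by (rule isCont_tendsto_compose)
  then show ?thesis unfolding tangent_cone_def
    using quot \<delta> t uW[OF add_nonneg_nonneg[OF t less_imp_le[OF \<delta>(2)]]]
    by (intro CollectI exI[of _ "\<lambda>k. u (t + \<delta> k)"] exI[of _ \<delta>]) auto
qed

text \<open>The linear function \<open>n\<close> attains its maximum over the curve at the interior time \<open>t\<close>.\<close>

lemma derivative_orthogonal_normal:
  fixes u :: "real \<Rightarrow> 'a::real_inner"
  assumes t: "0 < t" and uW: "\<And>s. 0 \<le> s \<Longrightarrow> u s \<in> W" and D: "(u has_vector_derivative D) (at t)"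
    and n: "\<And>y. y \<in> W \<Longrightarrow> n \<bullet> (y - u t) \<le> 0"
  shows "n \<bullet> D = 0"
proof (rule DERIV_local_max[OF _ t])
  show "((\<lambda>s. n \<bullet> u s) has_real_derivative n \<bullet> D) (at t)"
    unfolding has_real_derivative_iff_has_vector_derivative
    using bounded_linear.has_vector_derivative[OF bounded_linear_inner_right D, of n] .
  show "\<forall>s. \<bar>t - s\<bar> < t \<longrightarrow> n \<bullet> u s \<le> n \<bullet> u t"
  proof (intro allI impI)
    fix s assume "\<bar>t - s\<bar> < t"
    then show "n \<bullet> u s \<le> n \<bullet> u t" using n[OF uW, of s] by (simp add: inner_diff_right)
  qed
qed

lemma velocity_is_projected_subgradient:
  fixes u :: "real \<Rightarrow> 'a::euclidean_space"
  assumes Dom: "open Dom" "convex_on Dom h" and W: "convex W" "W \<subseteq> Dom"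
    and t: "0 < t" and uW: "\<And>s. 0 \<le> s \<Longrightarrow> u s \<in> W" and D: "(u has_vector_derivative D) (at t)"
    and ineq: "\<And>y. y \<in> W \<Longrightarrow> h (u t) + (- D) \<bullet> (y - u t) \<le> h y"
  shows "D \<in> proj_tangent W (u t) ` (uminus ` subdifferential Dom h (u t))"
proof -
  have "u t \<in> W" using t uW by simp
  then obtain p where p: "p \<in> subdifferential Dom h (u t)"
    and n: "\<And>y. y \<in> W \<Longrightarrow> (- D - p) \<bullet> (y - u t) \<le> 0"
    using subgradient_of_constrained[OF Dom W _ ineq] by blast
  have "proj_tangent W (u t) (D + (- D - p)) = D"
    using t by (intro proj_tangent_eqI n derivative_in_tangent_cone[OF _ uW D]
        derivative_orthogonal_normal[OF t uW D n]) auto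
  then have "proj_tangent W (u t) (- p) = D" by simp
  then show ?thesis using p by blast
qed

section \<open>Projected saddle flows\<close>

lemma abs_continuous_on_lipschitz:
  assumes lip: "L-lipschitz_on {a..b} u"
  shows "abs_continuous_on a b u"
  unfolding abs_continuous_on_def
proof (intro allI impI)
  fix e :: real assume e: "e > 0"
  have L: "0 \<le> L" using lip by (rule lipschitz_on_nonneg)
  have "(\<Sum>(c, d)\<in>I. dist (u c) (u d)) < e"
    if I: "finite I" "\<forall>(c, d)\<in>I. a \<le> c \<and> c \<le> d \<and> d \<le> b" "(\<Sum>(c, d)\<in>I. d - c) < e / (L + 1)" for I
  proof -
    have "(\<Sum>(c, d)\<in>I. dist (u c) (u d)) \<le> (\<Sum>i\<in>I. L * (case i of (c, d) \<Rightarrow> d - c))"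
    proof (rule sum_mono)
      fix i assume i: "i \<in> I"
      obtain c d where cd: "i = (c, d)" by (cases i)
      then have "a \<le> c \<and> c \<le> d \<and> d \<le> b" using I(2) i by auto
      then show "(case i of (c, d) \<Rightarrow> dist (u c) (u d)) \<le> L * (case i of (c, d) \<Rightarrow> d - c)"
        using lipschitz_onD[OF lip, of c d] by (simp add: cd dist_real_def)
    qed
    also have "\<dots> = L * (\<Sum>(c, d)\<in>I. d - c)" by (simp add: sum_distrib_left)
    also have "\<dots> \<le> L * (e / (L + 1))" using I(3) L by (intro mult_left_mono) auto
    also have "\<dots> < e" using e L by (simp add: field_simps)
    finally show ?thesis .
  qed
  then show "\<exists>\<delta>>0. \<forall>I. finite I \<and> (\<forall>(c, d)\<in>I. a \<le> c \<and> c \<le> d \<and> d \<le> b) \<and>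
        disjoint_family_on (\<lambda>(c, d). {c<..<d}) I \<and> (\<Sum>(c, d)\<in>I. d - c) < \<delta>
        \<longrightarrow> (\<Sum>(c, d)\<in>I. dist (u c) (u d)) < e"
    using e L by (intro exI[of _ "e / (L + 1)"]) auto
qed

lemma closed_nonneg_multipliers: "closed (nonneg_multipliers :: (real ^ 'm ^ 'v) set)"
proof -
  have "nonneg_multipliers = (\<Inter>i. \<Inter>k. {lam :: real ^ 'm ^ 'v. 0 \<le> lam $ i $ k})"
    by (auto simp: nonneg_multipliers_def)
  moreover have "closed \<dots>" by (intro closed_INT ballI closed_Collect_le continuous_intros)
  ultimately show ?thesis by (rule ssubst)
qed

lemma convex_nonneg_multipliers: "convex (nonneg_multipliers :: (real ^ 'm ^ 'v) set)"
  by (auto simp: convex_def nonneg_multipliers_def)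

text \<open>Monotonicity of the saddle operator enters through the choice of \<open>\<psi>\<close>: the two subgradient
  inequalities add up, and the value of \<open>L\<close> at the current state cancels. Continuity of \<open>\<psi>\<close> is
  automatic, since convex functions on open sets are continuous.\<close>

lemma projected_saddle_flow_exists:
  fixes L :: "'a::euclidean_space \<Rightarrow> real ^ 'm::finite ^ 'v::finite \<Rightarrow> real"
  assumes W: "closed W" "convex W" "W \<subseteq> Dom" and Dom: "open Dom"
    and cx: "\<And>lam. lam \<in> nonneg_multipliers \<Longrightarrow> convex_on Dom (\<lambda>y. L y lam)"
    and cl: "\<And>x. x \<in> W \<Longrightarrow> convex_on UNIV (\<lambda>mu. - L x mu)"
    and gx: "\<And>x lam p. x \<in> W \<Longrightarrow> lam \<in> nonneg_multipliers \<Longrightarrow>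
      p \<in> subdifferential Dom (\<lambda>y. L y lam) x \<Longrightarrow> norm p \<le> B * (1 + norm lam)"
    and gl: "\<And>x lam q. x \<in> W \<Longrightarrow> lam \<in> nonneg_multipliers \<Longrightarrow>
      q \<in> subdifferential UNIV (\<lambda>mu. - L x mu) lam \<Longrightarrow> norm q \<le> B * (1 + norm lam)"
    and x0: "x0 \<in> W" and lam0: "lam0 \<in> nonneg_multipliers"
  shows "\<exists>x lam. is_projected_saddle_flow W Dom L x0 lam0 x lam"
proof -
  define Z :: "('a \<times> (real ^ 'm ^ 'v)) set" where "Z = W \<times> nonneg_multipliers"
  define p where "p = (\<lambda>x lam. SOME p. p \<in> subdifferential Dom (\<lambda>y. L y lam) x)"
  define q where "q = (\<lambda>x lam. SOME q. q \<in> subdifferential UNIV (\<lambda>mu. - L x mu) lam)"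
  define V where "V = (\<lambda>(x, lam). (p x lam, q x lam))"
  define \<psi> where "\<psi> = (\<lambda>(y, mu) (x, lam). L x mu - L y lam)"
  have p: "p x lam \<in> subdifferential Dom (\<lambda>y. L y lam) x" if "x \<in> W" "lam \<in> nonneg_multipliers" for x lam
    unfolding p_def using subdifferential_nonempty[OF Dom cx[OF that(2)], of x] that W by (auto simp: some_in_eq)
  have q: "q x lam \<in> subdifferential UNIV (\<lambda>mu. - L x mu) lam" if "x \<in> W" for x lam
    unfolding q_def using subdifferential_nonempty[OF open_UNIV cl[OF that], of lam] by (simp add: some_in_eq)
  have "0 \<le> B * (1 + norm lam0)" using gx[OF x0 lam0 p[OF x0 lam0]] norm_ge_zero order_trans by blast
  moreover have "0 < 1 + norm lam0" by (simp add: add_pos_nonneg)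
  ultimately have B: "0 \<le> B" by (simp add: zero_le_mult_iff)
  interpret projected_dynamics Z V \<psi> "2 * B" "(x0, lam0)"
  proof
    show "closed Z" unfolding Z_def by (intro closed_Times W closed_nonneg_multipliers)
    show "convex Z" unfolding Z_def by (intro convex_Times W convex_nonneg_multipliers)
    show "(x0, lam0) \<in> Z" using x0 lam0 by (simp add: Z_def)
    show "0 \<le> 2 * B" using B by simp
    fix u assume "u \<in> Z"
    then obtain x lam where u: "u = (x, lam)" "x \<in> W" "lam \<in> nonneg_multipliers" by (auto simp: Z_def)
    have "norm (V u) \<le> norm (p x lam) + norm (q x lam)" unfolding u V_def using norm_Pair_le by auto
    also have "\<dots> \<le> 2 * B * (1 + norm lam)"
      using gx[OF u(2,3) p[OF u(2,3)]] gl[OF u(2,3) q[OF u(2)]] by simp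
    also have "\<dots> \<le> 2 * B * (1 + norm u)" using norm_snd_le[of lam x] B u by (intro mult_left_mono) auto
    finally show "norm (V u) \<le> 2 * B * (1 + norm u)" .
    fix z assume "z \<in> Z"
    then obtain y mu where z: "z = (y, mu)" "y \<in> W" "mu \<in> nonneg_multipliers" by (auto simp: Z_def)
    have "L x lam + p x lam \<bullet> (y - x) \<le> L y lam" using p[OF u(2,3)] z W by (auto simp: subdifferential_def)
    moreover have "- L x lam + q x lam \<bullet> (mu - lam) \<le> - L x mu" using q[OF u(2)] by (auto simp: subdifferential_def)
    ultimately show "\<psi> z u \<le> V u \<bullet> (u - z)" by (simp add: u z \<psi>_def V_def inner_diff_right)
  next
    fix z assume "z \<in> Z"
    then obtain y mu where z: "z = (y, mu)" "y \<in> W" "mu \<in> nonneg_multipliers" by (auto simp: Z_def)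
    have 1: "continuous_on Dom (\<lambda>x. L x mu)" by (rule convex_on_continuous[OF Dom cx[OF z(3)]])
    have 2: "continuous_on UNIV (\<lambda>lam. - L y lam)" by (rule convex_on_continuous[OF open_UNIV cl[OF z(2)]])
    have "continuous_on Z (\<lambda>u. L (fst u) mu + - L y (snd u))"
      by (intro continuous_on_add continuous_on_compose2[OF 1] continuous_on_compose2[OF 2] continuous_intros)
        (use W in \<open>auto simp: Z_def\<close>)
    then show "continuous_on Z (\<psi> z)" by (simp add: \<psi>_def z case_prod_beta)
  qed
  obtain u where u0: "u 0 = (x0, lam0)" and uZ: "\<And>t. 0 \<le> t \<Longrightarrow> u t \<in> Z"
    and lip: "\<And>T. (speed T)-lipschitz_on {0..T} u"
    and evi: "\<And>t z D. 0 \<le> t \<Longrightarrow> z \<in> Z \<Longrightarrow> (u has_vector_derivative D) (at t) \<Longrightarrow> \<psi> z (u t) \<le> - D \<bullet> (u t - z)"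
    using evolution_variational_inequality by blast
  define x where "x = (\<lambda>t. fst (u t))"
  define lam where "lam = (\<lambda>t. snd (u t))"
  have u: "u t = (x t, lam t)" for t by (simp add: x_def lam_def)
  have xW: "x t \<in> W" and lamN: "lam t \<in> nonneg_multipliers" if "0 \<le> t" for t
    using uZ[OF that] by (auto simp: u Z_def)
  define N where "N = (\<Union>n. {t. 0 < t \<and> t < real n \<and> (\<nexists>D. (u has_vector_derivative D) (at t))})"
  have "negligible N" unfolding N_def
    using lipschitz_ae_vector_derivative[OF lip] by (intro negligible_countable_Union) auto
  then have "negligible (insert 0 N)" by (simp add: negligible_insert)
  then have "AE t in lebesgue. t \<notin> insert 0 N"
    unfolding negligible_iff_null_sets by (rule AE_not_in)
  then have ae: "AE t in lebesgue. 0 \<le> t \<longrightarrow>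
        (\<exists>x' lam'.
           (x has_vector_derivative x') (at t within {0..}) \<and>
           (lam has_vector_derivative lam') (at t within {0..}) \<and>
           x' \<in> proj_tangent W (x t) `
                  (uminus ` subdifferential Dom (\<lambda>y. L y (lam t)) (x t)) \<and>
           lam' \<in> proj_tangent nonneg_multipliers (lam t) `
                  (uminus ` subdifferential UNIV (\<lambda>mu. - L (x t) mu) (lam t)))"
  proof (rule AE_mp[OF _ AE_I2], intro impI)
    fix t assume tN: "t \<notin> insert 0 N" and "0 \<le> t"
    then have t: "0 < t" by auto
    obtain n where "t < real n" using reals_Archimedean2 by blast
    then obtain D where D: "(u has_vector_derivative D) (at t)" using tN t by (auto simp: N_def)
    obtain x' lam' where D': "D = (x', lam')" by (cases D)
    have dx: "(x has_vector_derivative x') (at t)"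
      using bounded_linear.has_vector_derivative[OF bounded_linear_fst D] by (simp add: x_def D')
    have dl: "(lam has_vector_derivative lam') (at t)"
      using bounded_linear.has_vector_derivative[OF bounded_linear_snd D] by (simp add: lam_def D')
    have xt: "x t \<in> W" "lam t \<in> nonneg_multipliers" using xW lamN t by auto
    have "x' \<in> proj_tangent W (x t) ` (uminus ` subdifferential Dom (\<lambda>y. L y (lam t)) (x t))"
    proof (rule velocity_is_projected_subgradient[OF Dom cx[OF xt(2)] W(2,3) t xW dx])
      \<comment> \<open>Comparing with \<open>z = (y, \<lambda>)\<close> isolates the \<open>x\<close> component.\<close>
      fix y assume "y \<in> W"
      then show "L (x t) (lam t) + - x' \<bullet> (y - x t) \<le> L y (lam t)"
        using evi[of t "(y, lam t)" D] xt t D by (simp add: Z_def u D' \<psi>_def inner_diff_right)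
    qed
    moreover have "lam' \<in> proj_tangent nonneg_multipliers (lam t) ` (uminus ` subdifferential UNIV (\<lambda>mu. - L (x t) mu) (lam t))"
    proof (rule velocity_is_projected_subgradient[OF open_UNIV cl[OF xt(1)] convex_nonneg_multipliers subset_UNIV t lamN dl])
      fix mu :: "real ^ 'm ^ 'v" assume "mu \<in> nonneg_multipliers"
      then show "- L (x t) (lam t) + - lam' \<bullet> (mu - lam t) \<le> - L (x t) mu"
        using evi[of t "(x t, mu)" D] xt t D by (simp add: Z_def u D' \<psi>_def inner_diff_right)
    qed
    ultimately show "\<exists>x' lam'.
           (x has_vector_derivative x') (at t within {0..}) \<and>
           (lam has_vector_derivative lam') (at t within {0..}) \<and>
           x' \<in> proj_tangent W (x t) `
                  (uminus ` subdifferential Dom (\<lambda>y. L y (lam t)) (x t)) \<and>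
           lam' \<in> proj_tangent nonneg_multipliers (lam t) `
                  (uminus ` subdifferential UNIV (\<lambda>mu. - L (x t) mu) (lam t))"
      using has_vector_derivative_at_within[OF dx] has_vector_derivative_at_within[OF dl] by blast
  qed
  have lipx: "(speed T)-lipschitz_on {0..T} x" "(speed T)-lipschitz_on {0..T} lam" for T
    using lip[of T] unfolding lipschitz_on_def x_def lam_def
    by (meson dist_fst_le dist_snd_le order_trans)+
  have "is_projected_saddle_flow W Dom L x0 lam0 x lam"
    unfolding is_projected_saddle_flow_def
    using u0 xW lamN ae abs_continuous_on_lipschitz[OF lipx(1)] abs_continuous_on_lipschitz[OF lipx(2)]
    by (simp add: u)
  then show ?thesis by blast
qed

section \<open>The modified Lagrangian\<close>

lemma strictly_convex_on_imp_convex_on: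
  assumes "strictly_convex_on D h"
  shows "convex_on D h"
proof (rule convex_onI)
  fix t x y assume t: "0 < t" "t < (1::real)" and xy: "x \<in> D" "y \<in> D"
  show "h ((1 - t) *\<^sub>R x + t *\<^sub>R y) \<le> (1 - t) * h x + t * h y"
  proof (cases "x = y")
    case True
    then show ?thesis by (simp flip: scaleR_add_left distrib_right)
  next
    case False
    then show ?thesis using assms t xy unfolding strictly_convex_on_def by (simp add: less_imp_le)
  qed
qed (use assms in \<open>simp add: strictly_convex_on_def\<close>)

lemma convex_on_compose_linear:
  assumes "linear l" "convex_on T h" "convex S" "l ` S \<subseteq> T"
  shows "convex_on S (\<lambda>x. h (l x))"
proof (rule convex_onI)
  fix t x y assume "0 < t" "t < (1::real)" "x \<in> S" "y \<in> S"
  then show "h (l ((1 - t) *\<^sub>R x + t *\<^sub>R y)) \<le> (1 - t) * h (l x) + t * h (l y)"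
    using assms(2,4) by (simp add: linear_add[OF assms(1)] linear_cmul[OF assms(1)] convex_on_def image_subset_iff)
qed fact

lemma convex_on_sum_functions:
  assumes "finite I" "convex S" "\<And>i. i \<in> I \<Longrightarrow> convex_on S (h i)"
  shows "convex_on S (\<lambda>x. \<Sum>i\<in>I. h i x)"
  using assms(1,3) by (induction I rule: finite_induct) (auto simp: convex_on_const assms(2) intro: convex_on_add)

lemma linear_block: "linear (block own i)"
  by (rule linearI) (auto simp: block_def vec_eq_iff)

lemma block_prod_eq: "block_prod own S = (\<Inter>i. block own i -` S i)"
  by (auto simp: block_prod_def)

lemma convex_block_prod: "(\<And>i. convex (S i)) \<Longrightarrow> convex (block_prod own S)"
  unfolding block_prod_eq by (intro convex_INT convex_linear_vimage linear_block)

text \<open>Each \<open>D i\<close> is only relatively open in its block space, but blocks always lie in that space, so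
  the product is open in the full space of stacked vectors.\<close>

lemma open_block_prod:
  fixes own :: "'n::finite \<Rightarrow> 'v::finite"
  assumes "\<And>i. openin (top_of_set (block_space own i)) (S i)"
  shows "open (block_prod own S)"
proof -
  have "open (block own i -` S i)" for i
  proof -
    obtain T where T: "open T" "S i = block_space own i \<inter> T"
      using assms[of i] by (auto simp: openin_open)
    have "block own i -` S i = block own i -` T"
      by (auto simp: T block_space_def block_def)
    moreover have "open (block own i -` T)"
      using T(1) linear_continuous_on[of "block own i" UNIV] linear_block[of own i]
      by (intro open_vimage) (auto simp: linear_conv_bounded_linear)
    ultimately show ?thesis by simp
  qed
  then show ?thesis unfolding block_prod_eq by (intro open_INT) auto
qed

lemma compact_block_prod:
  fixes own :: "'n::finite \<Rightarrow> 'v"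
  assumes "\<And>i. compact (S i)"
  shows "compact (block_prod own S)"
proof -
  have "closed (block own i -` S i)" for i
    using compact_imp_closed[OF assms, of i] linear_continuous_on[of "block own i" UNIV] linear_block[of own i]
    by (intro closed_vimage) (auto simp: linear_conv_bounded_linear)
  then have "closed (block_prod own S)" unfolding block_prod_eq by (intro closed_INT) auto
  moreover have "\<exists>b. \<forall>y\<in>S i. norm y \<le> b" for i
    using compact_imp_bounded[OF assms, of i] by (simp add: bounded_iff)
  then obtain b where b: "\<And>i y. y \<in> S i \<Longrightarrow> norm y \<le> b i" by metis
  have "norm x \<le> (\<Sum>c\<in>UNIV. b (own c))" if x: "x \<in> block_prod own S" for x
  proof -
    have "\<bar>x $ c\<bar> \<le> b (own c)" for c
    proof -
      have "\<bar>x $ c\<bar> = \<bar>block own (own c) x $ c\<bar>" by (simp add: block_def)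
      also have "\<dots> \<le> norm (block own (own c) x)" by (rule component_le_norm_cart)
      also have "\<dots> \<le> b (own c)" using x b by (simp add: block_prod_def)
      finally show ?thesis .
    qed
    then show ?thesis using norm_le_l1_cart[of x] by (meson order_trans sum_mono)
  qed
  then have "bounded (block_prod own S)" by (auto simp: bounded_iff)
  ultimately show ?thesis by (simp add: compact_eq_bounded_closed)
qed

lemma l1_norm_triangle: "l1_norm (a + b) \<le> l1_norm a + l1_norm b"
  unfolding l1_norm_def by (simp flip: sum.distrib) (intro sum_mono abs_triangle_ineq)

lemma l1_norm_scale: "l1_norm (c *\<^sub>R a) = \<bar>c\<bar> * l1_norm a"
  unfolding l1_norm_def by (simp add: abs_mult sum_distrib_left)

lemma l1_norm_le: "l1_norm (a :: real ^ 'm::finite) \<le> CARD('m) * norm a"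
  unfolding l1_norm_def using sum_bounded_above[of UNIV "\<lambda>k. \<bar>a $ k\<bar>" "norm a"] component_le_norm_cart by force

lemma consensus_penalty_triangle:
  "consensus_penalty E (a + b) \<le> consensus_penalty E a + consensus_penalty E b"
proof -
  have "l1_norm ((a + b) $ i - (a + b) $ j) \<le> l1_norm (a $ i - a $ j) + l1_norm (b $ i - b $ j)" for i j
    using l1_norm_triangle[of "a $ i - a $ j" "b $ i - b $ j"] by (simp add: algebra_simps)
  then show ?thesis
    unfolding consensus_penalty_def by (simp flip: sum.distrib distrib_left add_divide_distrib) (intro divide_right_mono sum_mono, auto)
qed

lemma consensus_penalty_scale: "consensus_penalty E (c *\<^sub>R a) = \<bar>c\<bar> * consensus_penalty E a"
proof -
  have "l1_norm ((c *\<^sub>R a) $ i - (c *\<^sub>R a) $ j) = \<bar>c\<bar> * l1_norm (a $ i - a $ j)" for i j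
    using l1_norm_scale[of c "a $ i - a $ j"] by (simp add: scaleR_diff_right)
  then show ?thesis unfolding consensus_penalty_def by (simp add: sum_distrib_left)
qed

lemma convex_on_consensus_penalty: "convex_on UNIV (consensus_penalty E :: real ^ 'm::finite ^ 'v::finite \<Rightarrow> real)"
proof (rule convex_onI)
  fix t :: real and a b :: "real ^ 'm ^ 'v" assume "0 < t" "t < 1"
  then show "consensus_penalty E ((1 - t) *\<^sub>R a + t *\<^sub>R b) \<le> (1 - t) * consensus_penalty E a + t * consensus_penalty E b"
    using consensus_penalty_triangle[of E "(1 - t) *\<^sub>R a" "t *\<^sub>R b"] by (simp add: consensus_penalty_scale)
qed simp

lemma consensus_penalty_bounded:
  fixes E :: "'v::finite rel"
  obtains c where "0 \<le> c" "\<And>a :: real ^ 'm::finite ^ 'v. consensus_penalty E a \<le> c * norm a"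
proof
  let ?c = "1 / 2 * (\<Sum>i\<in>UNIV. \<Sum>j\<in>neighbors E i. real CARD('m) * 2)"
  show "0 \<le> ?c" by (intro mult_nonneg_nonneg[OF _ sum_nonneg] sum_nonneg) auto
  fix a :: "real ^ 'm ^ 'v"
  have "l1_norm (a $ i - a $ j) \<le> CARD('m) * 2 * norm a" for i j
  proof -
    have "norm (a $ i - a $ j) \<le> 2 * norm a"
      using norm_triangle_ineq4[of "a $ i" "a $ j"] Finite_Cartesian_Product.norm_nth_le[of a i]
        Finite_Cartesian_Product.norm_nth_le[of a j] by linarith
    then have "CARD('m) * norm (a $ i - a $ j) \<le> CARD('m) * (2 * norm a)" by (intro mult_left_mono) auto
    from order_trans[OF l1_norm_le this] show ?thesis by (simp only: mult.assoc)
  qed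
  then show "consensus_penalty E a \<le> ?c * norm a"
    unfolding consensus_penalty_def by (simp only: mult.assoc[of "1/2"] sum_distrib_right) (intro mult_left_mono sum_mono, auto)
qed

lemma modified_lagrangian_eq:
  "modified_lagrangian own E K f g x lam =
     (\<Sum>i\<in>UNIV. f i (block own i x)) + lam \<bullet> (\<chi> i. g i (block own i x)) - K * consensus_penalty E lam"
  by (simp add: modified_lagrangian_def sum.distrib inner_vec_def)

text \<open>Bounding subgradients on a compact set requires bounds on the function in a full
  neighbourhood of fixed radius.\<close>

lemma bounded_near_compact:
  fixes F :: "'a::heine_borel \<Rightarrow> 'b::real_normed_vector"
  assumes "compact W" "open D" "W \<subseteq> D" "continuous_on D F"
  obtains \<epsilon> B where "\<epsilon> > 0" "\<And>x y. x \<in> W \<Longrightarrow> dist x y \<le> \<epsilon> \<Longrightarrow> y \<in> D \<and> norm (F y) \<le> B"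
proof -
  obtain \<epsilon> where \<epsilon>: "\<epsilon> > 0" "(\<Union>x\<in>W. cball x \<epsilon>) \<subseteq> D"
    by (rule compact_subset_open_imp_cball_epsilon_subset[OF assms(1-3)])
  have "compact (F ` (\<Union>x\<in>W. cball x \<epsilon>))"
    by (intro compact_continuous_image continuous_on_subset[OF assms(4) \<epsilon>(2)] compact_minkowski_sum_cball assms(1))
  then have "bounded (F ` (\<Union>x\<in>W. cball x \<epsilon>))" by (rule compact_imp_bounded)
  then obtain B where "\<And>y. y \<in> (\<Union>x\<in>W. cball x \<epsilon>) \<Longrightarrow> norm (F y) \<le> B"
    unfolding bounded_iff by blast
  then show ?thesis using that[of \<epsilon> B] \<epsilon> by force
qed

text \<open>Evaluate the subgradient inequality at distance \<open>e\<close> in the direction of \<open>p\<close> itself.\<close>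

lemma norm_subgradient_le:
  assumes p: "p \<in> subdifferential D h x" and e: "e > 0" "cball x e \<subseteq> D"
    and B: "\<And>y. y \<in> cball x e \<Longrightarrow> h y - h x \<le> B"
  shows "norm p \<le> B / e"
proof (cases "p = 0")
  case True
  have "0 \<le> B" using B[of x] e by simp
  then show ?thesis using True e by simp
next
  case False
  define y where "y = x + (e / norm p) *\<^sub>R p"
  have y: "y \<in> cball x e" using e False by (simp add: y_def dist_norm)
  then have "h x + p \<bullet> (y - x) \<le> h y" using p e by (auto simp: subdifferential_def)
  moreover have "p \<bullet> (y - x) = e * norm p"
    using False by (simp add: y_def power2_norm_eq_inner[symmetric] power2_eq_square)
  ultimately have "e * norm p \<le> B" using B[OF y] by linarith
  then show ?thesis using e by (simp add: field_simps)
qed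

theorem mainTheorem3:
  fixes own :: "'n::finite \<Rightarrow> 'v::finite"
    and E :: "'v rel"
    and \<Omega> D :: "'v \<Rightarrow> (real ^ 'n) set"
    and f :: "'v \<Rightarrow> real ^ 'n \<Rightarrow> real"
    and g :: "'v \<Rightarrow> real ^ 'n \<Rightarrow> real ^ 'm::finite"
    and K :: real
    and xbar x0 :: "real ^ 'n"
    and lam0 :: "real ^ 'm ^ 'v"
  assumes K_pos: "0 < K"
    and D_open: "\<And>i. openin (top_of_set (block_space own i)) (D i)"
    and D_convex: "\<And>i. convex (D i)"
    and \<Omega>_subset: "\<And>i. \<Omega> i \<subseteq> D i"
    and \<Omega>_compact: "\<And>i. compact (\<Omega> i)"
    and \<Omega>_convex: "\<And>i. convex (\<Omega> i)"
    and f_strictly_convex: "\<And>i. strictly_convex_on (D i) (f i)"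
    and g_convex: "\<And>i k. convex_on (D i) (\<lambda>y. g i y $ k)"
    and f_lipschitz: "\<And>i. locally_lipschitz_on (D i) (f i)"
    and g_lipschitz: "\<And>i. locally_lipschitz_on (D i) (g i)"
    and slater_point: "xbar \<in> rel_interior (block_prod own \<Omega>)"
    and slater_strict: "\<And>k. (\<Sum>i\<in>UNIV. g i (block own i xbar)) $ k < 0"
    and graph_undirected: "sym E"
    and graph_connected: "\<And>i j. (i, j) \<in> E\<^sup>*"
    and x0_mem: "x0 \<in> block_prod own \<Omega>"
    and lam0_mem: "lam0 \<in> nonneg_multipliers"
  shows "\<exists>x lam. is_projected_saddle_flow (block_prod own \<Omega>) (block_prod own D)
           (modified_lagrangian own E K f g) x0 lam0 x lam"
proof -
  define W where "W = block_prod own \<Omega>"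
  define Dom where "Dom = block_prod own D"
  define F where "F = (\<lambda>x. \<Sum>i\<in>UNIV. f i (block own i x))"
  define G :: "real ^ 'n \<Rightarrow> real ^ 'm ^ 'v" where "G = (\<lambda>x. \<chi> i. g i (block own i x))"
  define L where "L = modified_lagrangian own E K f g"
  have L: "L x lam = F x + lam \<bullet> G x - K * consensus_penalty E lam" for x lam
    unfolding L_def F_def G_def by (rule modified_lagrangian_eq)
  have W: "compact W" "convex W" "W \<subseteq> Dom"
    unfolding W_def Dom_def
  proof -
    show "compact (block_prod own \<Omega>)" by (intro compact_block_prod \<Omega>_compact)
    show "convex (block_prod own \<Omega>)" by (intro convex_block_prod \<Omega>_convex)
    show "block_prod own \<Omega> \<subseteq> block_prod own D" using \<Omega>_subset by (auto simp: block_prod_def)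
  qed
  have Dom: "open Dom" "convex Dom"
    unfolding Dom_def by (intro open_block_prod convex_block_prod D_open D_convex)+
  have block_D: "block own i ` Dom \<subseteq> D i" for i by (auto simp: Dom_def block_prod_def)
  have F_convex: "convex_on Dom F" unfolding F_def
    by (intro convex_on_sum_functions convex_on_compose_linear[OF linear_block _ Dom(2) block_D]
        strictly_convex_on_imp_convex_on f_strictly_convex Dom) auto
  have G_convex: "convex_on Dom (\<lambda>x. G x $ i $ k)" for i k
    unfolding G_def using convex_on_compose_linear[OF linear_block g_convex Dom(2) block_D] by simp
  have "continuous_on Dom (\<lambda>x. \<chi> i. \<chi> k. G x $ i $ k)"
    by (intro continuous_on_vec_lambda convex_on_continuous Dom G_convex)
  then have cont: "continuous_on Dom (\<lambda>x. (F x, G x))"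
    by (intro continuous_on_Pair convex_on_continuous[OF Dom(1) F_convex]) (simp add: vec_lambda_eta)
  obtain \<epsilon> B0 where \<epsilon>: "\<epsilon> > 0" and B0: "\<And>x y. x \<in> W \<Longrightarrow> dist x y \<le> \<epsilon> \<Longrightarrow> y \<in> Dom \<and> norm (F y, G y) \<le> B0"
    using bounded_near_compact[OF W(1) Dom(1) W(3) cont] by blast
  have near: "y \<in> Dom" "\<bar>F y\<bar> \<le> B0" "norm (G y) \<le> B0" if "x \<in> W" "dist x y \<le> \<epsilon>" for x y
    using B0[OF that] norm_fst_le[of "F y" "G y"] norm_snd_le[of "G y" "F y"] by auto
  have B0_nonneg: "0 \<le> B0" using near(2)[of x0 x0] x0_mem \<epsilon> by (simp add: W_def)
  obtain c where c: "0 \<le> c" "\<And>a :: real ^ 'm ^ 'v. consensus_penalty E a \<le> c * norm a"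
    using consensus_penalty_bounded by blast
  \<comment> \<open>The two entries bound the subgradients in \<open>x\<close> and in \<open>\<lambda>\<close>, respectively.\<close>
  define B where "B = max (2 * B0 / \<epsilon>) (B0 + K * c)"
  have "\<exists>x lam. is_projected_saddle_flow W Dom L x0 lam0 x lam"
  proof (rule projected_saddle_flow_exists)
    show "closed W" using W compact_imp_closed by blast
    show "convex W" "W \<subseteq> Dom" "open Dom" by fact+
    show "x0 \<in> W" "lam0 \<in> nonneg_multipliers" using x0_mem lam0_mem by (auto simp: W_def)
    fix lam :: "real ^ 'm ^ 'v" assume lam: "lam \<in> nonneg_multipliers"
    have "convex_on Dom (\<lambda>y. F y + (\<Sum>i\<in>UNIV. \<Sum>k\<in>UNIV. lam $ i $ k * G y $ i $ k) + - (K * consensus_penalty E lam))"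
      using lam by (intro convex_on_add F_convex convex_on_sum_functions convex_on_cmul G_convex Dom)
        (auto simp: nonneg_multipliers_def convex_on_const Dom)
    then show "convex_on Dom (\<lambda>y. L y lam)" by (simp add: L inner_vec_def)
    fix x p assume x: "x \<in> W" and p: "p \<in> subdifferential Dom (\<lambda>y. L y lam) x"
    have "norm p \<le> 2 * B0 * (1 + norm lam) / \<epsilon>"
    proof (rule norm_subgradient_le[OF p \<epsilon>])
      show "cball x \<epsilon> \<subseteq> Dom" using near(1)[OF x] by auto
      fix y assume "y \<in> cball x \<epsilon>"
      then have y: "dist x y \<le> \<epsilon>" by simp
      have xx: "dist x x \<le> \<epsilon>" using \<epsilon> by simp
      have "lam \<bullet> (G y - G x) \<le> norm lam * norm (G y - G x)" by (rule norm_cauchy_schwarz)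
      also have "\<dots> \<le> norm lam * (2 * B0)"
        using norm_triangle_ineq4[of "G y" "G x"] near(3)[OF x y] near(3)[OF x xx] by (intro mult_left_mono) auto
      finally show "L y lam - L x lam \<le> 2 * B0 * (1 + norm lam)"
        using near(2)[OF x y] near(2)[OF x xx] by (simp add: L inner_diff_right algebra_simps abs_le_iff)
    qed
    also have "\<dots> = 2 * B0 / \<epsilon> * (1 + norm lam)" by simp
    also have "\<dots> \<le> B * (1 + norm lam)" by (intro mult_right_mono) (auto simp: B_def)
    finally show "norm p \<le> B * (1 + norm lam)" .
  next
    fix x assume x: "x \<in> W"
    have xx: "dist x x \<le> \<epsilon>" using \<epsilon> by simp
    have "convex_on UNIV (\<lambda>mu. - (mu \<bullet> G x))"
      by (rule convex_onI) (auto simp: inner_add_left)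
    then have "convex_on UNIV (\<lambda>mu. K * consensus_penalty E mu + (- (mu \<bullet> G x) + - F x))"
      using K_pos by (intro convex_on_add convex_on_cmul convex_on_consensus_penalty) (auto simp: convex_on_const)
    then show "convex_on UNIV (\<lambda>mu. - L x mu)" by (simp add: L algebra_simps)
    fix lam q assume q: "q \<in> subdifferential UNIV (\<lambda>mu. - L x mu) lam"
    have "norm q \<le> (B0 + K * c) / 1"
    proof (rule norm_subgradient_le[OF q])
      fix mu :: "real ^ 'm ^ 'v" assume mu: "mu \<in> cball lam 1"
      then have m: "norm (mu - lam) \<le> 1" by (simp add: dist_norm norm_minus_commute)
      have "(lam - mu) \<bullet> G x \<le> norm (lam - mu) * norm (G x)" by (rule norm_cauchy_schwarz)
      also have "\<dots> \<le> 1 * B0" using m near(3)[OF x xx] by (intro mult_mono) (auto simp: norm_minus_commute)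
      finally have 1: "(lam - mu) \<bullet> G x \<le> B0" by simp
      have "consensus_penalty E mu - consensus_penalty E lam \<le> consensus_penalty E (mu - lam)"
        using consensus_penalty_triangle[of E "mu - lam" lam] by simp
      also have "\<dots> \<le> c * norm (mu - lam)" by (rule c)
      also have "\<dots> \<le> c * 1" using m c by (intro mult_left_mono)
      finally have "K * (consensus_penalty E mu - consensus_penalty E lam) \<le> K * c" using K_pos by simp
      with 1 show "- L x mu - - L x lam \<le> B0 + K * c" by (simp add: L inner_diff_left algebra_simps)
    qed auto
    also have "\<dots> \<le> B * 1" by (simp add: B_def)
    also have "\<dots> \<le> B * (1 + norm lam)"
    proof (rule mult_left_mono)
      show "0 \<le> B" using \<epsilon> B0_nonneg by (simp add: B_def le_max_iff_disj)
    qed simp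
    finally show "norm q \<le> B * (1 + norm lam)" .
  qed
  then show ?thesis by (simp add: W_def Dom_def L_def)
qed

end
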